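(* Let $\Omega$ be a domain in $\mathbb{R}^m$, let $u, v\in W^2(\Omega)$ be real-valued functions and let $\vec F=(F_1,\dots,F_m)\in W^1(\Omega)$ be a vector field. Suppose that for some constant $C>0$, $|\nabla u+\vec F|\ge C$, $|\nabla v+\vec F|\ge C$ and $N_{\vec F}(u) = N_{\vec F}(v)$ in $\Omega$ (a.e.). Assume $$ m\ge \operatorname{rank}(h_{IJ})\ge 3 $$ in $\Omega$ (a.e.). Then $\nabla u=\nabla v$ in $\Omega$ (a.e.).
   Context: $W^k(\Omega)$ denotes the space of $k$ times weakly differentiable functions on $\Omega$ (locally integrable functions all of whose weak derivatives up to order $k$ exist as locally integrable functions), applied componentwise for vector fields. For a function $w$ with $\nabla w+\vec F\ne0$ a.e., the horizontal normal is $N_{\vec F}(w) := \frac{\nabla w+\vec F}{|\nabla w+\vec F|}$. $h_{IJ} := \partial_I F_J-\partial_J F_I$ (weak derivatives) for $1\le I,J\le m$, regarded as an $m\times m$ matrix. The integer $m$ need not be even. *)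

theory Defs
  imports "HOL-Analysis.Analysis"
begin

definition partial_deriv :: "'m::finite \<Rightarrow> (real^'m \<Rightarrow> real) \<Rightarrow> real^'m \<Rightarrow> real" where
  "partial_deriv i f = (\<lambda>x. frechet_derivative f (at x) (axis i 1))"

(* Classical iterated partial derivatives; a multi-index is given as a list of coordinate
   directions (repetitions allowed), whose length is the order. *)
definition iterated_partial :: "'m::finite list \<Rightarrow> (real^'m \<Rightarrow> real) \<Rightarrow> real^'m \<Rightarrow> real" where
  "iterated_partial js f = foldr partial_deriv js f"

(* Smooth functions with compact support in \<Omega>. If all iterated partial derivatives are
   (Frechet) differentiable everywhere then they are all continuous, so this is C^infinity. *)
definition test_function :: "(real^'m::finite) set \<Rightarrow> (real^'m \<Rightarrow> real) \<Rightarrow> bool" where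
  "test_function \<Omega> \<phi> \<longleftrightarrow>
     (\<forall>js x. iterated_partial js \<phi> differentiable (at x)) \<and>
     compact (closure {x. \<phi> x \<noteq> 0}) \<and> closure {x. \<phi> x \<noteq> 0} \<subseteq> \<Omega>"

definition locally_integrable_on :: "(real^'m::finite \<Rightarrow> real) \<Rightarrow> (real^'m) set \<Rightarrow> bool" where
  "locally_integrable_on f \<Omega> \<longleftrightarrow>
     (\<forall>K. compact K \<and> K \<subseteq> \<Omega> \<longrightarrow> set_integrable lebesgue K f)"

definition has_weak_deriv ::
  "(real^'m::finite) set \<Rightarrow> 'm list \<Rightarrow> (real^'m \<Rightarrow> real) \<Rightarrow> (real^'m \<Rightarrow> real) \<Rightarrow> bool" where
  "has_weak_deriv \<Omega> js f g \<longleftrightarrow>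
     locally_integrable_on f \<Omega> \<and> locally_integrable_on g \<Omega> \<and>
     (\<forall>\<phi>. test_function \<Omega> \<phi> \<longrightarrow>
        set_lebesgue_integral lebesgue \<Omega> (\<lambda>x. f x * iterated_partial js \<phi> x) =
        (-1) ^ length js * set_lebesgue_integral lebesgue \<Omega> (\<lambda>x. g x * \<phi> x))"

definition weakly_diff_space :: "nat \<Rightarrow> (real^'m::finite) set \<Rightarrow> (real^'m \<Rightarrow> real) set" where
  "weakly_diff_space k \<Omega> =
     {f. locally_integrable_on f \<Omega> \<and>
         (\<forall>js. length js \<le> k \<longrightarrow> (\<exists>g. has_weak_deriv \<Omega> js f g))}"

definition weakly_diff_fields ::
  "nat \<Rightarrow> (real^'m::finite) set \<Rightarrow> (real^'m \<Rightarrow> real^'m) set" where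
  "weakly_diff_fields k \<Omega> = {F. \<forall>i. (\<lambda>x. F x $ i) \<in> weakly_diff_space k \<Omega>}"

(* Weak derivatives are determined only up to null sets of \<Omega>: this is an arbitrary
   representative, to be used only in statements holding almost everywhere in \<Omega>. *)
definition weak_partial ::
  "(real^'m::finite) set \<Rightarrow> 'm \<Rightarrow> (real^'m \<Rightarrow> real) \<Rightarrow> real^'m \<Rightarrow> real" where
  "weak_partial \<Omega> i f = (SOME g. has_weak_deriv \<Omega> [i] f g)"

definition weak_grad ::
  "(real^'m::finite) set \<Rightarrow> (real^'m \<Rightarrow> real) \<Rightarrow> real^'m \<Rightarrow> real^'m" where
  "weak_grad \<Omega> f x = (\<chi> i. weak_partial \<Omega> i f x)"

definition horizontal_normal ::
  "(real^'m::finite) set \<Rightarrow> (real^'m \<Rightarrow> real^'m) \<Rightarrow> (real^'m \<Rightarrow> real) \<Rightarrow> real^'m \<Rightarrow> real^'m" where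
  "horizontal_normal \<Omega> F w x =
     (weak_grad \<Omega> w x + F x) /\<^sub>R norm (weak_grad \<Omega> w x + F x)"

definition curl_matrix ::
  "(real^'m::finite) set \<Rightarrow> (real^'m \<Rightarrow> real^'m) \<Rightarrow> real^'m \<Rightarrow> real^'m^'m" where
  "curl_matrix \<Omega> F x =
     (\<chi> I J. weak_partial \<Omega> I (\<lambda>y. F y $ J) x - weak_partial \<Omega> J (\<lambda>y. F y $ I) x)"

end

theory Submission
  imports Defs "HOL-Computational_Algebra.Polynomial"
begin

text \<open>
  Write \<open>U = \<nabla>u + F\<close>, \<open>V = \<nabla>v + F\<close> and \<open>w = \<nabla>u - \<nabla>v = U - V\<close>. Equality of the normals
  makes \<open>U\<close> and \<open>V\<close> parallel, hence \<open>U\<^sub>i w\<^sub>j = U\<^sub>j w\<^sub>i\<close> almost everywhere. Differentiating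
  this identity in direction \<open>k\<close> and adding the three cyclic permutations of \<open>(i, j, k)\<close>, all
  terms with derivatives of \<open>w\<close> and all second derivatives of \<open>u\<close> cancel by symmetry of second
  weak derivatives, and what is left is
  \<open>h\<^sub>k\<^sub>i w\<^sub>j + h\<^sub>i\<^sub>j w\<^sub>k + h\<^sub>j\<^sub>k w\<^sub>i = 0\<close>, that is, \<open>h \<and> w = 0\<close>. Where \<open>w \<noteq> 0\<close>, this expresses
  all rows of the matrix \<open>h\<close> through two vectors (\<open>rank_le_2_of_cyclic_identity\<close>), which
  contradicts \<open>rank h \<ge> 3\<close>.

  The analytic difficulty is the differentiation: \<open>U\<^sub>i\<close> and \<open>w\<^sub>j\<close> are only of class \<open>W\<^sup>1\<close>, so their
  product need not have a weak derivative. It suffices to differentiate pointwise. If \<open>g\<close> is the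
  weak derivative of \<open>f\<close> in direction \<open>e\<close>, then along a suitable sequence \<open>h\<^sub>n \<rightarrow> 0\<close> the difference
  quotients \<open>(f (x + h\<^sub>n e) - f x) / h\<^sub>n\<close> converge to \<open>g x\<close> for almost every \<open>x\<close>, with one
  sequence for any finite family of functions (\<open>local_difference_quotients\<close>); the product rule
  for an identity between products then follows as in calculus (\<open>parallel_product_rule\<close>). The
  convergence rests on \<open>f (x + h e) - f x = h \<integral>\<^sub>0\<^sup>1 g (x + s h e) ds\<close> for almost every \<open>x\<close>
  (\<open>weak_increment\<close>) and on the continuity of translations in \<open>L\<^sup>1\<close> (\<open>L1_translation\<close>): together
  they give convergence in \<open>L\<^sup>1\<close> of the difference quotients, hence convergence almost everywhere
  of a subsequence.

  Weak derivatives are tested only against explicit smooth bumps supported in boxes. They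
  approximate indicators of boxes, so they are numerous enough to separate integrable functions.
\<close>

section \<open>Smooth bumps\<close>

text \<open>For \<open>P = 1\<close> this is the classical smooth function that vanishes to infinite order at \<open>0\<close>.
  The polynomial factor makes the family closed under differentiation.\<close>
definition flat :: "real poly \<Rightarrow> real \<Rightarrow> real" where
  "flat P t = (if t > 0 then poly P (1 / t) * exp (- (1 / t)) else 0)"

lemma poly_exp_tendsto_0: "((\<lambda>y::real. poly Q y * exp (- y)) \<longlongrightarrow> 0) at_top"
proof -
  have "((\<lambda>y::real. \<Sum>i\<le>degree Q. coeff Q i * (y ^ i / exp y)) \<longlongrightarrow> (\<Sum>i\<le>degree Q. coeff Q i * 0)) at_top"
    by (intro tendsto_intros tendsto_power_div_exp_0)
  moreover have "(\<lambda>y::real. \<Sum>i\<le>degree Q. coeff Q i * (y ^ i / exp y)) = (\<lambda>y. poly Q y * exp (- y))"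
    by (simp add: poly_altdef sum_divide_distrib exp_minus field_simps)
  ultimately show ?thesis by simp
qed

lemma flat_has_derivative:
  "(flat P has_real_derivative flat ([:0,0,1:] * (P - pderiv P)) t) (at t)"
proof -
  consider "t > 0" | "t < 0" | "t = 0" by linarith
  then show ?thesis
  proof cases
    case 1
    have "((\<lambda>t. poly P (1 / t) * exp (- (1 / t))) has_real_derivative
        flat ([:0,0,1:] * (P - pderiv P)) t) (at t)"
      using 1 by (auto intro!: derivative_eq_intros DERIV_chain'[OF _ poly_DERIV]
          simp: flat_def field_simps power2_eq_square)
    moreover have "\<forall>\<^sub>F y in nhds t. flat P y = poly P (1 / y) * exp (- (1 / y))"
      using eventually_nhds_in_open[of "{0<..}" t] 1
      by (auto simp: flat_def elim!: eventually_mono)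
    ultimately show ?thesis by (simp add: DERIV_cong_ev)
  next
    case 2
    have "((\<lambda>t. 0) has_real_derivative 0) (at t)" by simp
    moreover have "\<forall>\<^sub>F y in nhds t. flat P y = 0"
      using eventually_nhds_in_open[of "{..<0}" t] 2
      by (auto simp: flat_def elim!: eventually_mono)
    ultimately show ?thesis using 2 by (simp add: DERIV_cong_ev flat_def)
  next
    case 3
    have "((\<lambda>h. flat P h / h) \<longlongrightarrow> 0) (at_left 0)"
      by (rule tendsto_eventually) (auto simp: flat_def eventually_at_left_field intro: exI[of _ "-1"])
    moreover have "((\<lambda>h. flat P h / h) \<longlongrightarrow> 0) (at_right 0)"
    proof -
      have "((\<lambda>h::real. poly ([:0,1:] * P) (1 / h) * exp (- (1 / h))) \<longlongrightarrow> 0) (at_right 0)"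
        using filterlim_compose[OF poly_exp_tendsto_0[of "[:0,1:] * P"] filterlim_inverse_at_top_right]
        by (simp add: divide_inverse)
      moreover have "\<forall>\<^sub>F h in at_right 0. poly ([:0,1:] * P) (1 / h) * exp (- (1 / h)) = flat P h / h"
        by (auto simp: flat_def eventually_at_right_field intro: exI[of _ 1])
      ultimately show ?thesis by (rule Lim_transform_eventually)
    qed
    ultimately have "((\<lambda>h. flat P h / h) \<longlongrightarrow> 0) (at 0)"
      by (simp add: filterlim_split_at)
    then show ?thesis using 3 by (simp add: DERIV_def flat_def)
  qed
qed

lemma flat_one_nonneg: "flat 1 t \<ge> 0"
  and flat_one_le_1: "flat 1 t \<le> 1"
  by (auto simp: flat_def)

text \<open>Scaling by \<open>Suc n\<close> rather than \<open>n\<close> keeps every member of the sequence a bump.\<close>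
lemma flat_one_scaled_tendsto:
  "(\<lambda>n. flat 1 (real (Suc n) * t)) \<longlonglongrightarrow> of_bool (t > 0)"
proof (cases "t > 0")
  case True
  have "(\<lambda>n. exp (- ((1 / t) * inverse (real (Suc n))))) \<longlonglongrightarrow> exp (- ((1 / t) * 0))"
    by (intro tendsto_intros LIMSEQ_inverse_real_of_nat)
  moreover have "flat 1 (real (Suc n) * t) = exp (- ((1 / t) * inverse (real (Suc n))))" for n
    using True by (simp add: flat_def divide_inverse mult_ac del: of_nat_Suc)
  ultimately show ?thesis using True by simp
next
  case False
  then have "\<not> real (Suc n) * t > 0" for n
    by (simp add: zero_less_mult_iff)
  then have "flat 1 (real (Suc n) * t) = 0" for n
    unfolding flat_def by presburger
  then show ?thesis using False by simp
qed

text \<open>Smoothness of a bump is proved by closing the needed functions under algebraic operations: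
  partial derivatives stay in the class and each member is differentiable, so members are
  infinitely differentiable. The symmetry of second partial derivatives is also an easy induction
  over the class.\<close>
inductive smooth_alg :: "(real^'m::finite \<Rightarrow> real) \<Rightarrow> bool" where
  flat: "smooth_alg (\<lambda>x. flat P (c * x $ i + d))"
| const: "smooth_alg (\<lambda>x. c)"
| add: "smooth_alg f \<Longrightarrow> smooth_alg g \<Longrightarrow> smooth_alg (\<lambda>x. f x + g x)"
| mult: "smooth_alg f \<Longrightarrow> smooth_alg g \<Longrightarrow> smooth_alg (\<lambda>x. f x * g x)"

lemma partial_deriv_add:
  assumes "\<And>x. f differentiable (at x)" "\<And>x. g differentiable (at x)"
  shows "partial_deriv k (\<lambda>x. f x + g x) = (\<lambda>x. partial_deriv k f x + partial_deriv k g x)"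
proof
  fix x
  have "((\<lambda>x. f x + g x) has_derivative
     (\<lambda>h. frechet_derivative f (at x) h + frechet_derivative g (at x) h)) (at x)"
    using assms by (intro has_derivative_add) (auto simp: frechet_derivative_works)
  from frechet_derivative_at[OF this, symmetric] show "partial_deriv k (\<lambda>x. f x + g x) x =
    partial_deriv k f x + partial_deriv k g x"
    by (simp add: partial_deriv_def)
qed

lemma partial_deriv_mult:
  assumes "\<And>x. f differentiable (at x)" "\<And>x. g differentiable (at x)"
  shows "partial_deriv k (\<lambda>x. f x * g x) =
    (\<lambda>x. partial_deriv k f x * g x + f x * partial_deriv k g x)"
proof
  fix x
  have "((\<lambda>x. f x * g x) has_derivative
     (\<lambda>h. f x * frechet_derivative g (at x) h + frechet_derivative f (at x) h * g x)) (at x)"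
    using assms by (intro has_derivative_mult) (auto simp: frechet_derivative_works)
  from frechet_derivative_at[OF this, symmetric] show "partial_deriv k (\<lambda>x. f x * g x) x =
    partial_deriv k f x * g x + f x * partial_deriv k g x"
    by (simp add: partial_deriv_def)
qed

lemma flat_coord_has_derivative:
  "((\<lambda>x. flat P (c * x $ i + d)) has_derivative
     (\<lambda>h. c * h $ i * flat ([:0,0,1:] * (P - pderiv P)) (c * x $ i + d))) (at x)"
proof -
  have "((\<lambda>x. c * x $ i + d) has_derivative (\<lambda>h. c * h $ i)) (at x)"
    by (auto intro!: derivative_eq_intros bounded_linear.has_derivative[OF bounded_linear_vec_nth])
  from has_derivative_compose[OF this flat_has_derivative[unfolded has_field_derivative_def]]
  show ?thesis by (simp add: mult_ac)
qed

lemma partial_deriv_flat_coord: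
  "partial_deriv k (\<lambda>x. flat P (c * x $ i + d)) =
     (\<lambda>x. (if k = i then c else 0) * flat ([:0,0,1:] * (P - pderiv P)) (c * x $ i + d))"
  unfolding partial_deriv_def frechet_derivative_at[OF flat_coord_has_derivative, symmetric]
  by (auto simp: axis_def)

lemma partial_deriv_const: "partial_deriv k (\<lambda>x. c) = (\<lambda>x. 0)"
  by (simp add: partial_deriv_def fun_eq_iff)

lemma smooth_alg_differentiable: "smooth_alg f \<Longrightarrow> f differentiable (at x)"
proof (induction rule: smooth_alg.induct)
  case (flat P c i d)
  show ?case using flat_coord_has_derivative differentiableI by blast
qed auto

lemma smooth_alg_partial_deriv: "smooth_alg f \<Longrightarrow> smooth_alg (partial_deriv k f)"
proof (induction rule: smooth_alg.induct)
  case (flat P c i d)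
  show ?case unfolding partial_deriv_flat_coord by (intro smooth_alg.intros)
next
  case (const c)
  show ?case unfolding partial_deriv_const by (intro smooth_alg.intros)
qed (simp_all add: partial_deriv_add partial_deriv_mult smooth_alg_differentiable smooth_alg.intros)

lemma smooth_alg_iterated_partial: "smooth_alg f \<Longrightarrow> smooth_alg (iterated_partial js f)"
  unfolding iterated_partial_def by (induction js) (auto intro: smooth_alg_partial_deriv)

lemma smooth_alg_partial_deriv_commute:
  "smooth_alg f \<Longrightarrow> partial_deriv i (partial_deriv j f) = partial_deriv j (partial_deriv i f)"
proof (induction rule: smooth_alg.induct)
  case (flat P c l d)
  show ?case
    by (simp add: partial_deriv_flat_coord partial_deriv_mult partial_deriv_const
        smooth_alg_differentiable smooth_alg.intros)
next
  case (mult f g)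
  then show ?case
    by (simp add: partial_deriv_mult partial_deriv_add smooth_alg_differentiable
        smooth_alg_partial_deriv smooth_alg.intros add_ac)
qed (simp_all add: partial_deriv_const partial_deriv_add smooth_alg_differentiable
        smooth_alg_partial_deriv smooth_alg.intros)

lemma smooth_alg_continuous: "smooth_alg f \<Longrightarrow> continuous_on UNIV f"
  by (simp add: smooth_alg_differentiable differentiable_imp_continuous_within
      continuous_at_imp_continuous_on)

text \<open>Positive exactly on \<open>box a b\<close>; the index \<open>n\<close> sharpens the bump towards the indicator.\<close>
definition bump :: "nat \<Rightarrow> real^'m::finite \<Rightarrow> real^'m \<Rightarrow> real^'m \<Rightarrow> real" where
  "bump n a b x = (\<Prod>i\<in>UNIV. flat 1 (real (Suc n) * (x $ i - a $ i)) *
                               flat 1 (real (Suc n) * (b $ i - x $ i)))"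

lemma smooth_alg_prod:
  "finite I \<Longrightarrow> (\<And>i. i \<in> I \<Longrightarrow> smooth_alg (f i)) \<Longrightarrow> smooth_alg (\<lambda>x. \<Prod>i\<in>I. f i x)"
  by (induction rule: finite_induct) (auto intro: smooth_alg.intros)

lemma smooth_alg_bump: "smooth_alg (bump n a b)"
proof -
  have 1: "smooth_alg (\<lambda>x. flat 1 (real (Suc n) * (x $ i - a $ i)))" for i
    using smooth_alg.flat[of 1 "real (Suc n)" i "- real (Suc n) * a $ i"]
    by (simp add: algebra_simps)
  have 2: "smooth_alg (\<lambda>x. flat 1 (real (Suc n) * (b $ i - x $ i)))" for i
    using smooth_alg.flat[of 1 "- real (Suc n)" i "real (Suc n) * b $ i"]
    by (simp add: algebra_simps)
  show ?thesis
    unfolding bump_def[abs_def] by (intro smooth_alg_prod smooth_alg.mult 1 2) auto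
qed

lemma bump_nonneg: "bump n a b x \<ge> 0" and bump_le_1: "bump n a b x \<le> 1"
  unfolding bump_def
  by (auto intro!: prod_nonneg prod_le_1 mult_le_one mult_nonneg_nonneg flat_one_nonneg flat_one_le_1)

lemma bump_eq_0:
  assumes "x \<notin> box a b"
  shows "bump n a b x = 0"
proof -
  have *: "flat 1 (real (Suc n) * t) = 0" if "t \<le> 0" for t
    using that by (simp add: flat_def zero_less_mult_iff del: of_nat_Suc)
  obtain i where "\<not> (a $ i < x $ i \<and> x $ i < b $ i)"
    using assms by (auto simp: mem_box_cart)
  then have "x $ i - a $ i \<le> 0 \<or> b $ i - x $ i \<le> 0" by linarith
  then have "flat 1 (real (Suc n) * (x $ i - a $ i)) * flat 1 (real (Suc n) * (b $ i - x $ i)) = 0"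
    using * by (metis mult_eq_0_iff)
  then show ?thesis
    unfolding bump_def by (intro prod_zero finite) (rule bexI[OF _ UNIV_I])
qed

lemma bump_translate: "bump n a b (x - d) = bump n (a + d) (b + d) x"
  by (simp add: bump_def algebra_simps)

lemma bump_tendsto_indicator: "(\<lambda>n. bump n a b x) \<longlonglongrightarrow> indicator (box a b) x"
proof -
  have "(\<lambda>n. bump n a b x) \<longlonglongrightarrow> (\<Prod>i\<in>UNIV. of_bool (x $ i - a $ i > 0) * of_bool (b $ i - x $ i > 0))"
    unfolding bump_def by (intro tendsto_intros flat_one_scaled_tendsto)
  moreover have "(\<Prod>i\<in>UNIV. of_bool (x $ i - a $ i > 0) * of_bool (b $ i - x $ i > 0))
    = (indicator (box a b) x :: real)"
    by (auto simp: indicator_def mem_box_cart)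
  ultimately show ?thesis by simp
qed

lemma flat_bounded: "bounded (range (flat P))"
proof -
  have "\<forall>\<^sub>F y in at_top. dist (poly P y * exp (- y)) 0 < 1"
    using poly_exp_tendsto_0 by (rule tendstoD) simp
  then obtain N where N: "\<And>y. y \<ge> N \<Longrightarrow> \<bar>poly P y * exp (- y)\<bar> < 1"
    by (auto simp: eventually_at_top_linorder)
  have "continuous_on {0..N} (\<lambda>y. poly P y * exp (- y))"
    by (intro continuous_intros)
  then have "bounded ((\<lambda>y. poly P y * exp (- y)) ` {0..N})"
    by (intro compact_imp_bounded compact_continuous_image) auto
  then obtain B where B: "\<forall>y\<in>{0..N}. \<bar>poly P y * exp (- y)\<bar> \<le> B"
    by (auto simp: bounded_iff)
  have "\<bar>flat P t\<bar> \<le> max 1 (\<bar>B\<bar>)" for t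
  proof (cases "t > 0")
    case True
    then show ?thesis
      using N[of "1 / t"] B[rule_format, of "1 / t"] by (cases "1 / t \<ge> N") (auto simp: flat_def)
  qed (simp add: flat_def)
  then show ?thesis by (auto simp: bounded_iff)
qed

lemma smooth_alg_bounded: "smooth_alg f \<Longrightarrow> bounded (range f)"
proof (induction rule: smooth_alg.induct)
  case (flat P c i d)
  show ?case by (rule bounded_subset[OF flat_bounded[of P]]) auto
next
  case (add f g)
  then obtain A B where "\<And>x. \<bar>f x\<bar> \<le> A" "\<And>x. \<bar>g x\<bar> \<le> B" by (auto simp: bounded_iff)
  then have "\<bar>f x + g x\<bar> \<le> A + B" for x by (meson abs_triangle_ineq add_mono order_trans)
  then show ?case by (auto simp: bounded_iff)
next
  case (mult f g)
  then obtain A B where "\<And>x. \<bar>f x\<bar> \<le> A" "\<And>x. \<bar>g x\<bar> \<le> B" by (auto simp: bounded_iff)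
  then have "\<bar>f x * g x\<bar> \<le> A * B" for x by (simp add: abs_mult mult_mono')
  then show ?case by (auto simp: bounded_iff)
qed auto

lemma partial_deriv_translate:
  assumes "\<And>x. f differentiable (at x)"
  shows "partial_deriv k (\<lambda>x. f (x - c)) = (\<lambda>x. partial_deriv k f (x - c))"
proof
  fix x
  have "((\<lambda>x. x - c) has_derivative (\<lambda>h. h)) (at x)"
    by (auto intro!: derivative_eq_intros)
  from has_derivative_compose[OF this, of f "frechet_derivative f (at (x - c))"]
  have "((\<lambda>x. f (x - c)) has_derivative frechet_derivative f (at (x - c))) (at x)"
    using assms by (simp add: frechet_derivative_works)
  from frechet_derivative_at[OF this, symmetric]
  show "partial_deriv k (\<lambda>x. f (x - c)) x = partial_deriv k f (x - c)"
    by (simp add: partial_deriv_def)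
qed

lemma borel_measurable_bump[measurable]: "bump n a b \<in> borel_measurable borel"
  by (rule borel_measurable_continuous_onI[OF smooth_alg_continuous[OF smooth_alg_bump]])

lemma test_function_smooth_alg:
  assumes \<phi>: "smooth_alg \<phi>" and supp: "\<And>x. x \<notin> cbox a b \<Longrightarrow> \<phi> x = 0" and "cbox a b \<subseteq> \<Omega>"
  shows "test_function \<Omega> \<phi>"
proof -
  have "closure {x. \<phi> x \<noteq> 0} \<subseteq> cbox a b"
    using supp by (intro closure_minimal) auto
  moreover from this have "compact (closure {x. \<phi> x \<noteq> 0})"
    by (meson bounded_cbox bounded_subset closed_closure compact_eq_bounded_closed)
  ultimately show ?thesis
    using assms(3) smooth_alg_differentiable[OF smooth_alg_iterated_partial[OF \<phi>]]
    by (auto simp: test_function_def)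
qed

lemma bump_eq_0_cbox: "x \<notin> cbox a b \<Longrightarrow> bump n a b x = 0"
  using bump_eq_0 box_subset_cbox by blast

lemma partial_deriv_bump_eq_0:
  assumes "x \<notin> cbox a b"
  shows "partial_deriv k (bump n a b) x = 0"
proof -
  have "(bump n a b has_derivative (\<lambda>h. 0)) (at x)"
  proof (rule has_derivative_transform_within_open[where f = "\<lambda>x. 0" and s = "- cbox a b"])
    show "open (- cbox a b)" by (rule open_Compl, rule closed_cbox)
  qed (use assms in \<open>auto simp: bump_eq_0_cbox\<close>)
  from frechet_derivative_at[OF this, symmetric] show ?thesis
    by (simp add: partial_deriv_def)
qed

section \<open>Integrable functions are determined by their integrals against bumps\<close>

text \<open>Boxes form an intersection-stable generator of the Borel sets, so by a Dynkin argument the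
  integrals over all Borel sets vanish as well.\<close>
lemma AE_eq_0_if_box_integrals_0:
  fixes r :: "'a::euclidean_space \<Rightarrow> real"
  assumes r: "integrable lborel r"
    and box: "\<And>a b. (\<integral>x. indicator (box a b) x * r x \<partial>lborel) = 0"
  shows "AE x in lborel. r x = 0"
proof (rule density_unique_real[OF r])
  have ind: "integrable lborel (\<lambda>x. indicator A x * r x)" if "A \<in> sets borel" for A
    using integrable_mult_indicator[OF _ r, of A] that by simp
  have total: "(\<integral>x. r x \<partial>lborel) = 0"
  proof -
    let ?B = "\<lambda>n::nat. box (- (real n *\<^sub>R One)) (real n *\<^sub>R One) :: 'a set"
    have "(\<lambda>n. \<integral>x. indicator (?B n) x * r x \<partial>lborel) \<longlonglongrightarrow> (\<integral>x. r x \<partial>lborel)"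
    proof (rule integral_dominated_convergence[where w = "\<lambda>x. norm (r x)"])
      show "AE x in lborel. (\<lambda>n. indicator (?B n) x * r x) \<longlonglongrightarrow> r x"
      proof (intro AE_I2)
        fix x :: 'a
        obtain m where m: "x \<in> ?B m" using UN_box_eq_UNIV by blast
        have "x \<in> ?B n" if "m \<le> n" for n
        proof -
          have "- real n < x \<bullet> i \<and> x \<bullet> i < real n" if "i \<in> Basis" for i
          proof -
            have "- real m < x \<bullet> i \<and> x \<bullet> i < real m"
              using m that by (simp add: mem_box inner_simps)
            with \<open>m \<le> n\<close> show ?thesis by linarith
          qed
          then show ?thesis by (simp add: mem_box inner_simps)
        qed
        then have "\<forall>\<^sub>F n in sequentially. indicator (?B n) x * r x = r x"
          by (auto simp: eventually_sequentially intro!: exI[of _ m])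
        then show "(\<lambda>n. indicator (?B n) x * r x) \<longlonglongrightarrow> r x"
          by (rule tendsto_eventually)
      qed
      show "(\<lambda>x. indicator (?B n) x * r x) \<in> borel_measurable lborel" for n
        by (rule borel_measurable_integrable[OF ind]) simp
      show "AE x in lborel. norm (indicator (?B n) x * r x) \<le> norm (r x)" for n
        by (intro AE_I2) (auto simp: indicator_def)
    qed (use r in simp_all)
    then show ?thesis using box by (simp add: LIMSEQ_const_iff)
  qed
  show "integrable lborel (\<lambda>x::'a. 0::real)" by simp
  fix A :: "'a set"
  assume "A \<in> sets lborel"
  then have A: "A \<in> sigma_sets UNIV (range (\<lambda>(a, b). box a b))"
    by (simp add: borel_eq_box)
  have "Int_stable (range (\<lambda>(a, b). box a b :: 'a set))"
    by (auto simp: Int_stable_def box_Int_box)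
  moreover have "range (\<lambda>(a, b). box a b :: 'a set) \<subseteq> Pow UNIV" by simp
  ultimately have "(\<integral>x. indicator A x * r x \<partial>lborel) = 0" using A
  proof (induction rule: sigma_sets_induct_disjoint)
    case (compl A)
    then have "A \<in> sets borel" by (simp add: borel_eq_box)
    have "(\<integral>x. indicator (UNIV - A) x * r x \<partial>lborel) = (\<integral>x. r x - indicator A x * r x \<partial>lborel)"
      by (rule Bochner_Integration.integral_cong) (auto simp: indicator_def)
    also have "\<dots> = 0"
      using compl total r ind[OF \<open>A \<in> sets borel\<close>] by simp
    finally show ?case .
  next
    case (union F)
    then have F: "\<And>i. F i \<in> sets lborel" by (simp add: borel_eq_box subset_eq)
    have "set_integrable lborel (\<Union>i. F i) r"
      unfolding set_integrable_def by (rule integrable_mult_indicator[OF _ r]) (use F in auto)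
    then have "(LINT x:(\<Union>i. F i)|lborel. r x) = (\<Sum>i. LINT x:F i|lborel. r x)"
      using F union.hyps(1)
      by (intro lebesgue_integral_countable_add) (blast dest: disjoint_family_onD)+
    then show ?case using union.IH by (simp add: set_lebesgue_integral_def)
  qed (use box in \<open>auto simp del: sigma_sets.intros\<close>)
  then show "set_lebesgue_integral lborel A r = set_lebesgue_integral lborel A (\<lambda>x. 0)"
    by (simp add: set_lebesgue_integral_def)
qed

text \<open>The fundamental lemma of the calculus of variations: bumps converge boundedly to indicators of
  boxes. The restriction of \<open>r\<close> to \<open>box p q\<close> then has vanishing integral over every box, because
  the intersection of two boxes is a box.\<close>
lemma AE_eq_0_if_bump_integrals_0:
  fixes r :: "real^'m::finite \<Rightarrow> real"
  assumes r: "integrable lborel r"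
    and bump: "\<And>n a b. box a b \<noteq> {} \<Longrightarrow> box a b \<subseteq> box p q \<Longrightarrow>
                 (\<integral>x. r x * bump n a b x \<partial>lborel) = 0"
  shows "AE x in lborel. x \<in> box p q \<longrightarrow> r x = 0"
proof -
  have meas[measurable]: "r \<in> borel_measurable borel" using r by auto
  have sub: "(\<integral>x. r x * indicator (box a b) x \<partial>lborel) = 0" if ab: "box a b \<subseteq> box p q" for a b
  proof (cases "box a b = {}")
    case False
    have "(\<lambda>n. \<integral>x. r x * bump n a b x \<partial>lborel) \<longlonglongrightarrow> (\<integral>x. r x * indicator (box a b) x \<partial>lborel)"
    proof (rule integral_dominated_convergence[where w = "\<lambda>x. norm (r x)"])
      show "AE x in lborel. (\<lambda>n. r x * bump n a b x) \<longlonglongrightarrow> r x * indicator (box a b) x"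
        by (intro AE_I2 tendsto_intros bump_tendsto_indicator)
      show "AE x in lborel. norm (r x * bump n a b x) \<le> norm (r x)" for n
        using bump_nonneg[of n a b] bump_le_1[of n a b]
        by (intro AE_I2) (auto simp: abs_mult intro!: mult_left_le)
    qed (use r in auto)
    then show ?thesis using bump[OF False ab] by (simp add: LIMSEQ_const_iff)
  qed simp
  have "AE x in lborel. indicator (box p q) x * r x = 0"
  proof (rule AE_eq_0_if_box_integrals_0)
    show "integrable lborel (\<lambda>x. indicator (box p q) x * r x)"
      using integrable_mult_indicator[OF _ r, of "box p q"] by simp
    fix a b
    obtain c d where cd: "box a b \<inter> box p q = box c d" using box_Int_box[of a b p q] by blast
    have "(\<integral>x. indicator (box a b) x * (indicator (box p q) x * r x) \<partial>lborel) =
       (\<integral>x. r x * indicator (box c d) x \<partial>lborel)"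
      by (rule Bochner_Integration.integral_cong)
         (auto simp: cd[symmetric] indicator_inter_arith)
    also have "\<dots> = 0" using sub[of c d] cd by blast
    finally show "(\<integral>x. indicator (box a b) x * (indicator (box p q) x * r x) \<partial>lborel) = 0" .
  qed
  then show ?thesis by (auto simp: indicator_def elim!: eventually_mono split: if_splits)
qed

section \<open>Weak derivatives as integrals along segments\<close>

lemma
  fixes f :: "'a::euclidean_space \<Rightarrow> real"
  shows integrable_translate: "integrable lborel f \<Longrightarrow> integrable lborel (\<lambda>x. f (x + d))"
    and integral_translate: "f \<in> borel_measurable borel \<Longrightarrow> (\<integral>x. f (x + d) \<partial>lborel) = (\<integral>x. f x \<partial>lborel)"
proof -
  have [measurable]: "(+) d \<in> lborel \<rightarrow>\<^sub>M borel" by simp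
  {
    assume f: "integrable lborel f"
    then have "integrable (distr lborel borel ((+) d)) f" by (simp add: lborel_distr_plus)
    with f show "integrable lborel (\<lambda>x. f (x + d))"
      by (subst (asm) integrable_distr_eq) (auto simp: add.commute)
  }
  {
    assume f: "f \<in> borel_measurable borel"
    have "(\<integral>x. f x \<partial>lborel) = (\<integral>x. f x \<partial>distr lborel borel ((+) d))" by (simp add: lborel_distr_plus)
    also have "\<dots> = (\<integral>x. f (x + d) \<partial>lborel)"
      using f by (subst integral_distr) (auto simp: add.commute)
    finally show "(\<integral>x. f (x + d) \<partial>lborel) = (\<integral>x. f x \<partial>lborel)" ..
  }
qed

lemma integral_translate_mult:
  fixes f g :: "'a::euclidean_space \<Rightarrow> real"
  assumes [measurable]: "f \<in> borel_measurable borel" "g \<in> borel_measurable borel"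
  shows "(\<integral>x. f (x + d) * g x \<partial>lborel) = (\<integral>x. f x * g (x - d) \<partial>lborel)"
  using integral_translate[of "\<lambda>x. f x * g (x - d)" d] by simp

text \<open>The integrability behind every exchange of the integral over space with the integral over a
  segment.\<close>
lemma integrable_sweep:
  fixes g :: "'a::euclidean_space \<Rightarrow> real" and d :: 'a
  assumes g: "integrable lborel g"
  shows "integrable (lborel \<Otimes>\<^sub>M lborel) (\<lambda>(s::real, x). indicator {0..1} s * g (x + s *\<^sub>R d))"
proof (rule lborel_pair.Fubini_integrable)
  have [measurable]: "g \<in> borel_measurable borel" using g by auto
  show "(\<lambda>(s::real, x). indicator {0..1} s * g (x + s *\<^sub>R d)) \<in> borel_measurable (lborel \<Otimes>\<^sub>M lborel)"
    by measurable
  have "(\<integral>y. norm (case (s, y) of (s::real, x) \<Rightarrow> indicator {0..1} s * g (x + s *\<^sub>R d)) \<partial>lborel)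
     = indicator {0..1} s * (\<integral>y. norm (g y) \<partial>lborel)" for s
    using integral_translate[of "\<lambda>y. norm (g y)" "s *\<^sub>R d"] by (simp add: abs_mult)
  then show "integrable lborel (\<lambda>s. \<integral>y. norm (case (s, y) of (s::real, x) \<Rightarrow> indicator {0..1} s * g (x + s *\<^sub>R d)) \<partial>lborel)"
    by simp
  show "AE s in lborel. integrable lborel (\<lambda>y. case (s, y) of (s::real, x) \<Rightarrow> indicator {0..1} s * g (x + s *\<^sub>R d))"
    using integrable_translate[OF g] by (intro AE_I2) simp
qed

lemma smooth_alg_increment:
  assumes "smooth_alg \<phi>"
  shows "\<phi> (x - h *\<^sub>R axis k 1) - \<phi> x =
    (\<integral>s. - h * partial_deriv k \<phi> (x - s *\<^sub>R h *\<^sub>R axis k 1) * indicator {0..1} s \<partial>lborel)"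
proof -
  let ?e = "h *\<^sub>R axis k 1 :: real^'a"
  have "(\<integral>s. - h * partial_deriv k \<phi> (x - s *\<^sub>R ?e) * indicator {0..1} s \<partial>lborel)
     = \<phi> (x - 1 *\<^sub>R ?e) - \<phi> (x - 0 *\<^sub>R ?e)"
  proof (rule integral_FTC_Icc_real)
    fix s :: real
    have d: "((\<lambda>s. x - s *\<^sub>R ?e) has_derivative (\<lambda>t. - (t *\<^sub>R ?e))) (at s)"
      by (auto intro!: derivative_eq_intros)
    have lin: "linear (frechet_derivative \<phi> (at y))" for y
      using smooth_alg_differentiable[OF assms] by (rule linear_frechet_derivative)
    have 1: "((\<lambda>s. \<phi> (x - s *\<^sub>R ?e)) has_derivative
         (\<lambda>t. frechet_derivative \<phi> (at (x - s *\<^sub>R ?e)) (- (t *\<^sub>R ?e)))) (at s)"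
      by (rule has_derivative_compose[OF d])
         (use smooth_alg_differentiable[OF assms] in \<open>simp add: frechet_derivative_works\<close>)
    have 2: "frechet_derivative \<phi> (at (x - s *\<^sub>R ?e)) (- (t *\<^sub>R ?e)) =
        - h * partial_deriv k \<phi> (x - s *\<^sub>R ?e) * t" for t
      by (simp only: linear_neg[OF lin] linear_scale[OF lin] partial_deriv_def) simp
    show "((\<lambda>s. \<phi> (x - s *\<^sub>R ?e)) has_real_derivative
        - h * partial_deriv k \<phi> (x - s *\<^sub>R ?e)) (at s)"
      unfolding has_field_derivative_def
      by (intro has_derivative_eq_rhs[OF 1] ext 2)
    have "continuous_on UNIV (\<lambda>s. - h * partial_deriv k \<phi> (x - s *\<^sub>R ?e))"
      by (intro continuous_intros
          continuous_on_compose2[OF smooth_alg_continuous[OF smooth_alg_partial_deriv[OF assms]]]) auto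
    then show "isCont (\<lambda>s. - h * partial_deriv k \<phi> (x - s *\<^sub>R ?e)) s"
      by (simp add: continuous_on_eq_continuous_at)
  qed simp
  then show ?thesis by simp
qed

text \<open>The fundamental theorem of calculus for weak derivatives. Tested against a bump \<open>\<phi>\<close>, the
  increment of \<open>f\<close> turns by translation into the increment of \<open>\<phi>\<close>, which is an integral of
  \<open>\<partial>\<^sub>k \<phi>\<close> along the segment. For each position on the segment the translate of \<open>\<phi>\<close> is again
  a bump, so the weak derivative moves \<open>\<partial>\<^sub>k\<close> over to \<open>f\<close>; Fubini's theorem turns the result into
  the integral of the right-hand side against \<open>\<phi>\<close>.\<close>
lemma weak_increment:
  fixes f g :: "real^'m::finite \<Rightarrow> real" and k :: 'm
  defines "e \<equiv> axis k 1"
  assumes f: "integrable lborel f" and g: "integrable lborel g"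
    and weak: "\<And>n a b. cbox a b \<subseteq> W \<Longrightarrow>
        (\<integral>x. f x * partial_deriv k (bump n a b) x \<partial>lborel) = - (\<integral>x. g x * bump n a b x \<partial>lborel)"
    and sub: "\<And>s. 0 \<le> s \<Longrightarrow> s \<le> 1 \<Longrightarrow> cbox (p + s *\<^sub>R h *\<^sub>R e) (q + s *\<^sub>R h *\<^sub>R e) \<subseteq> W"
  shows "AE x in lborel. x \<in> box p q \<longrightarrow>
     f (x + h *\<^sub>R e) - f x = h * (\<integral>s. indicator {0..1} s * g (x + s *\<^sub>R h *\<^sub>R e) \<partial>lborel)"
proof -
  have [measurable]: "f \<in> borel_measurable borel" "g \<in> borel_measurable borel" using f g by auto
  define d where "d = h *\<^sub>R e"
  define G where "G x = (\<integral>s. indicator {0..1} s * g (x + s *\<^sub>R d) \<partial>lborel)" for x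
  have G: "integrable lborel G"
    using lborel_pair.integrable_snd[OF integrable_sweep[OF g, of d]] by (simp add: G_def[abs_def])
  have fd: "integrable lborel (\<lambda>x. f (x + d))" by (rule integrable_translate[OF f])
  have bdd: "integrable lborel (\<lambda>x. F x * \<psi> x)"
    if F: "integrable lborel F" and \<psi>: "smooth_alg \<psi>" for F \<psi> :: "real^'m \<Rightarrow> real"
  proof -
    obtain B where B: "\<And>x. \<bar>\<psi> x\<bar> \<le> B" using smooth_alg_bounded[OF \<psi>] by (auto simp: bounded_iff)
    have [measurable]: "\<psi> \<in> borel_measurable borel" "F \<in> borel_measurable borel"
      using borel_measurable_continuous_onI[OF smooth_alg_continuous[OF \<psi>]] F by auto
    have "integrable lborel (\<lambda>x. B * F x)" using F by simp
    then show ?thesis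
    proof (rule Bochner_Integration.integrable_bound)
      show "AE x in lborel. norm (F x * \<psi> x) \<le> norm (B * F x)"
        using order_trans[OF B abs_ge_self]
        by (intro AE_I2) (auto simp: abs_mult mult.commute[of "\<bar>F _\<bar>"] intro!: mult_right_mono)
    qed measurable
  qed
  have "AE x in lborel. x \<in> box p q \<longrightarrow> f (x + d) - f x - h * G x = 0"
  proof (rule AE_eq_0_if_bump_integrals_0)
    show "integrable lborel (\<lambda>x. f (x + d) - f x - h * G x)" using f fd G by simp
    fix n and a b :: "real^'m"
    assume ne: "box a b \<noteq> {}" and ab: "box a b \<subseteq> box p q"
    define \<phi> where "\<phi> = bump n a b"
    have \<phi>: "smooth_alg \<phi>" unfolding \<phi>_def by (rule smooth_alg_bump)
    have \<phi>': "smooth_alg (partial_deriv k \<phi>)" by (rule smooth_alg_partial_deriv[OF \<phi>])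
    note [measurable] = borel_measurable_continuous_onI[OF smooth_alg_continuous[OF \<phi>]]
      borel_measurable_continuous_onI[OF smooth_alg_continuous[OF \<phi>']]
    have ab': "cbox a b \<subseteq> cbox p q"
      using closure_minimal[OF order_trans[OF ab box_subset_cbox] closed_cbox] closure_box[OF ne] by simp
    have W: "cbox (a + s *\<^sub>R d) (b + s *\<^sub>R d) \<subseteq> W" if "0 \<le> s" "s \<le> 1" for s
    proof
      fix x
      assume "x \<in> cbox (a + s *\<^sub>R d) (b + s *\<^sub>R d)"
      then have "x - s *\<^sub>R d \<in> cbox a b" by (simp add: mem_box_cart algebra_simps)
      with ab' have "x - s *\<^sub>R d \<in> cbox p q" by blast
      then have "x \<in> cbox (p + s *\<^sub>R d) (q + s *\<^sub>R d)" by (simp add: mem_box_cart algebra_simps)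
      then show "x \<in> W" using sub[OF that] unfolding d_def by blast
    qed
    \<comment> \<open>The defining relation of the weak derivative, for the bump translated by \<open>s d\<close>.\<close>
    have slice: "(\<integral>x. f x * partial_deriv k \<phi> (x - s *\<^sub>R d) \<partial>lborel) =
        - (\<integral>x. g (x + s *\<^sub>R d) * \<phi> x \<partial>lborel)" if "0 \<le> s" "s \<le> 1" for s
    proof -
      have "(\<lambda>x. partial_deriv k \<phi> (x - s *\<^sub>R d)) = partial_deriv k (bump n (a + s *\<^sub>R d) (b + s *\<^sub>R d))"
        using partial_deriv_translate[OF smooth_alg_differentiable[OF \<phi>], of k "s *\<^sub>R d"]
        by (simp add: \<phi>_def bump_translate)
      then have "(\<integral>x. f x * partial_deriv k \<phi> (x - s *\<^sub>R d) \<partial>lborel) =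
          - (\<integral>x. g x * bump n (a + s *\<^sub>R d) (b + s *\<^sub>R d) x \<partial>lborel)"
        using weak[OF W[OF that], of n] by metis
      also have "(\<integral>x. g x * bump n (a + s *\<^sub>R d) (b + s *\<^sub>R d) x \<partial>lborel) =
          (\<integral>x. g (x + s *\<^sub>R d) * \<phi> x \<partial>lborel)"
        by (simp add: integral_translate_mult \<phi>_def bump_translate)
      finally show ?thesis .
    qed
    \<comment> \<open>Both applications of Fubini's theorem are dominated by the swept functions, as \<open>\<phi>\<close> and
        \<open>\<partial>\<^sub>k \<phi>\<close> are bounded.\<close>
    have int1: "integrable (lborel \<Otimes>\<^sub>M lborel)
        (\<lambda>(s::real, x). indicator {0..1} s * (f x * (- h * partial_deriv k \<phi> (x - s *\<^sub>R d))))"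
    proof -
      obtain B where B: "\<And>x. \<bar>partial_deriv k \<phi> x\<bar> \<le> B"
        using smooth_alg_bounded[OF \<phi>'] by (auto simp: bounded_iff)
      have "integrable (lborel \<Otimes>\<^sub>M lborel) (\<lambda>y. (h * B) * (\<lambda>(s::real, x). indicator {0..1} s * f x) y)"
        using integrable_sweep[OF f, of 0] by (intro integrable_mult_right) (simp add: scaleR_zero_right)
      then show ?thesis
      proof (rule Bochner_Integration.integrable_bound)
        have "\<bar>h\<bar> * \<bar>partial_deriv k \<phi> x\<bar> \<le> \<bar>h * B\<bar>" for x
          unfolding abs_mult using order_trans[OF B abs_ge_self] by (rule mult_left_mono) simp
        then show "AE y in lborel \<Otimes>\<^sub>M lborel. norm ((\<lambda>(s::real, x). indicator {0..1} s *
            (f x * (- h * partial_deriv k \<phi> (x - s *\<^sub>R d)))) y)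
            \<le> norm ((h * B) * (\<lambda>(s::real, x). indicator {0..1} s * f x) y)"
          by (intro AE_I2) (auto simp: abs_mult[of "f _"] abs_mult[of h "partial_deriv _ _ _"]
              abs_mult[of "indicator _ _"] abs_mult[of "h * B"] indicator_def mult.commute[of _ "\<bar>f _\<bar>"]
              intro!: mult_left_mono)
      qed measurable
    qed
    have int2: "integrable (lborel \<Otimes>\<^sub>M lborel)
        (\<lambda>(s::real, x). indicator {0..1} s * g (x + s *\<^sub>R d) * (h * \<phi> x))"
    proof (rule Bochner_Integration.integrable_bound)
      show "integrable (lborel \<Otimes>\<^sub>M lborel) (\<lambda>y. h * (\<lambda>(s::real, x). indicator {0..1} s * g (x + s *\<^sub>R d)) y)"
        by (intro integrable_mult_right integrable_sweep[OF g])
      have "\<bar>\<phi> x\<bar> \<le> 1" for x using bump_nonneg[of n a b x] bump_le_1[of n a b x] by (simp add: \<phi>_def)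
      then show "AE y in lborel \<Otimes>\<^sub>M lborel. norm ((\<lambda>(s::real, x). indicator {0..1} s * g (x + s *\<^sub>R d) * (h * \<phi> x)) y)
          \<le> norm (h * (\<lambda>(s::real, x). indicator {0..1} s * g (x + s *\<^sub>R d)) y)"
        by (intro AE_I2) (auto simp: abs_mult indicator_def mult.assoc[symmetric]
            mult.commute[of _ "\<bar>h\<bar>"] intro!: mult_left_le)
    qed measurable
    have "(\<integral>x. (f (x + d) - f x) * \<phi> x \<partial>lborel) = (\<integral>x. f (x + d) * \<phi> x \<partial>lborel) - (\<integral>x. f x * \<phi> x \<partial>lborel)"
      using bdd[OF f \<phi>] bdd[OF fd \<phi>] by (simp add: left_diff_distrib)
    also have "\<dots> = (\<integral>x. f x * \<phi> (x - d) \<partial>lborel) - (\<integral>x. f x * \<phi> x \<partial>lborel)"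
      by (simp add: integral_translate_mult)
    also have "\<dots> = (\<integral>x. f x * (\<phi> (x - d) - \<phi> x) \<partial>lborel)"
    proof -
      have "smooth_alg (\<lambda>x. \<phi> (x - d))"
        by (simp add: \<phi>_def bump_translate smooth_alg_bump)
      then show ?thesis using bdd[OF f \<phi>] bdd[OF f, of "\<lambda>x. \<phi> (x - d)"]
        by (simp add: right_diff_distrib)
    qed
    also have "\<dots> = (\<integral>x. (\<integral>s. indicator {0..1} s * (f x * (- h * partial_deriv k \<phi> (x - s *\<^sub>R d))) \<partial>lborel) \<partial>lborel)"
      unfolding d_def e_def smooth_alg_increment[OF \<phi>] integral_mult_right_zero[symmetric]
      by (simp only: mult_ac)
    also have "\<dots> = (\<integral>s. (\<integral>x. indicator {0..1} s * (f x * (- h * partial_deriv k \<phi> (x - s *\<^sub>R d))) \<partial>lborel) \<partial>lborel)"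
      by (rule lborel_pair.Fubini_integral[OF int1])
    also have "\<dots> = (\<integral>s. (\<integral>x. indicator {0..1} s * g (x + s *\<^sub>R d) * (h * \<phi> x) \<partial>lborel) \<partial>lborel)"
    proof (rule Bochner_Integration.integral_cong[OF refl])
      fix s :: real
      have "(\<integral>x. indicator {0..1} s * (f x * (- h * partial_deriv k \<phi> (x - s *\<^sub>R d))) \<partial>lborel)
        = indicator {0..1} s * (- h * (\<integral>x. f x * partial_deriv k \<phi> (x - s *\<^sub>R d) \<partial>lborel))"
        unfolding integral_mult_right_zero[symmetric] by (simp only: mult_ac)
      also have "\<dots> = indicator {0..1} s * (h * (\<integral>x. g (x + s *\<^sub>R d) * \<phi> x \<partial>lborel))"
        by (cases "s \<in> {0..1}") (simp_all add: slice)
      also have "\<dots> = (\<integral>x. indicator {0..1} s * g (x + s *\<^sub>R d) * (h * \<phi> x) \<partial>lborel)"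
        unfolding integral_mult_right_zero[symmetric] by (simp only: mult_ac)
      finally show "(\<integral>x. indicator {0..1} s * (f x * (- h * partial_deriv k \<phi> (x - s *\<^sub>R d))) \<partial>lborel) =
         (\<integral>x. indicator {0..1} s * g (x + s *\<^sub>R d) * (h * \<phi> x) \<partial>lborel)" .
    qed
    also have "\<dots> = (\<integral>x. (\<integral>s. indicator {0..1} s * g (x + s *\<^sub>R d) * (h * \<phi> x) \<partial>lborel) \<partial>lborel)"
      by (rule lborel_pair.Fubini_integral[OF int2, symmetric])
    also have "\<dots> = (\<integral>x. h * G x * \<phi> x \<partial>lborel)"
      by (simp add: G_def mult_ac)
    finally have "(\<integral>x. (f (x + d) - f x) * \<phi> x \<partial>lborel) = (\<integral>x. h * G x * \<phi> x \<partial>lborel)" .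
    moreover have "(\<integral>x. (f (x + d) - f x - h * G x) * \<phi> x \<partial>lborel) =
        (\<integral>x. (f (x + d) - f x) * \<phi> x \<partial>lborel) - (\<integral>x. h * G x * \<phi> x \<partial>lborel)"
      using bdd[OF _ \<phi>, of "\<lambda>x. f (x + d) - f x"] bdd[OF _ \<phi>, of "\<lambda>x. h * G x"] f fd G
      by (simp add: left_diff_distrib[of "f _ - f _"])
    ultimately show "(\<integral>x. (f (x + d) - f x - h * G x) * bump n a b x \<partial>lborel) = 0"
      by (simp add: \<phi>_def)
  qed
  then show ?thesis by (simp add: G_def d_def)
qed

section \<open>Continuity of translations in mean\<close>

text \<open>Translation is an isometry of \<open>L\<^sup>1\<close>, so the functions on which it acts continuously form a
  closed set.\<close>
lemma L1_translation_approx: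
  fixes f :: "'a::euclidean_space \<Rightarrow> real"
  assumes f: "integrable lborel f"
    and approx: "\<And>e. e > 0 \<Longrightarrow> \<exists>g. integrable lborel g \<and> (\<integral>x. \<bar>f x - g x\<bar> \<partial>lborel) < e \<and>
                   (\<lambda>n. \<integral>x. \<bar>g (x + t n) - g x\<bar> \<partial>lborel) \<longlonglongrightarrow> 0"
  shows "(\<lambda>n. \<integral>x. \<bar>f (x + t n) - f x\<bar> \<partial>lborel) \<longlonglongrightarrow> 0"
proof (rule tendstoI)
  fix e :: real
  assume "e > 0"
  then obtain g where g: "integrable lborel g" and fg: "(\<integral>x. \<bar>f x - g x\<bar> \<partial>lborel) < e / 4"
    and conv: "(\<lambda>n. \<integral>x. \<bar>g (x + t n) - g x\<bar> \<partial>lborel) \<longlonglongrightarrow> 0"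
    using approx[of "e / 4"] by auto
  have fgi: "integrable lborel (\<lambda>x. \<bar>f x - g x\<bar>)" using f g by simp
  have meas[measurable]: "f \<in> borel_measurable borel" "g \<in> borel_measurable borel" using f g by auto
  have "\<forall>\<^sub>F n in sequentially. (\<integral>x. \<bar>g (x + t n) - g x\<bar> \<partial>lborel) < e / 2"
    using order_tendstoD(2)[OF conv, of "e / 2"] \<open>e > 0\<close> by simp
  then show "\<forall>\<^sub>F n in sequentially. dist (\<integral>x. \<bar>f (x + t n) - f x\<bar> \<partial>lborel) 0 < e"
  proof eventually_elim
    case (elim n)
    have "(\<integral>x. \<bar>f (x + t n) - f x\<bar> \<partial>lborel) \<le>
      (\<integral>x. \<bar>f (x + t n) - g (x + t n)\<bar> + \<bar>g (x + t n) - g x\<bar> + \<bar>f x - g x\<bar> \<partial>lborel)"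
      using f g integrable_translate[OF f, of "t n"] integrable_translate[OF g, of "t n"]
      by (intro integral_mono) auto
    also have "\<dots> = (\<integral>x. \<bar>f (x + t n) - g (x + t n)\<bar> \<partial>lborel) +
        (\<integral>x. \<bar>g (x + t n) - g x\<bar> \<partial>lborel) + (\<integral>x. \<bar>f x - g x\<bar> \<partial>lborel)"
      using f g integrable_translate[OF f, of "t n"] integrable_translate[OF g, of "t n"] by simp
    also have "(\<integral>x. \<bar>f (x + t n) - g (x + t n)\<bar> \<partial>lborel) = (\<integral>x. \<bar>f x - g x\<bar> \<partial>lborel)"
      by (rule integral_translate) simp
    finally have "(\<integral>x. \<bar>f (x + t n) - f x\<bar> \<partial>lborel) < e" using elim fg by simp
    then show ?case by simp
  qed
qed

text \<open>Points of an open set stay in it under small translations, so the part of \<open>U\<close> that is moved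
  out of \<open>U\<close> has measure tending to \<open>0\<close> by dominated convergence. Translation preserves measure,
  so the part that is moved in has equal measure.\<close>
lemma L1_translation_open:
  fixes U :: "'a::euclidean_space set"
  assumes U: "open U" and fin: "emeasure lborel U < \<infinity>" and t: "t \<longlonglongrightarrow> 0"
  shows "(\<lambda>n. \<integral>x. \<bar>indicator U (x + t n) - indicator U x :: real\<bar> \<partial>lborel) \<longlonglongrightarrow> 0"
proof -
  let ?i = "indicator U :: 'a \<Rightarrow> real"
  have [measurable]: "U \<in> sets borel" using U by simp
  have i: "integrable lborel ?i" using fin by simp
  have i2: "integrable lborel (\<lambda>x. ?i x * (1 - ?i (x + t n)))" for n
    by (rule Bochner_Integration.integrable_bound[OF i]) (auto simp: indicator_def)
  have "(\<lambda>n. \<integral>x. ?i x * (1 - ?i (x + t n)) \<partial>lborel) \<longlonglongrightarrow> (\<integral>x. 0 \<partial>(lborel :: 'a measure))"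
  proof (rule integral_dominated_convergence[where w = ?i])
    show "AE x in lborel. (\<lambda>n. ?i x * (1 - ?i (x + t n))) \<longlonglongrightarrow> 0"
    proof (intro AE_I2)
      fix x :: 'a
      show "(\<lambda>n. ?i x * (1 - ?i (x + t n))) \<longlonglongrightarrow> 0"
      proof (cases "x \<in> U")
        case True
        have "(\<lambda>n. x + t n) \<longlonglongrightarrow> x + 0" by (intro tendsto_intros t)
        then have "\<forall>\<^sub>F n in sequentially. x + t n \<in> U"
          using U True by (simp add: topological_tendstoD)
        then show ?thesis by (intro tendsto_eventually) (elim eventually_mono, simp)
      qed simp
    qed
  qed (use i in \<open>auto simp: indicator_def intro!: AE_I2\<close>)
  then have "(\<lambda>n. 2 * (\<integral>x. ?i x * (1 - ?i (x + t n)) \<partial>lborel)) \<longlonglongrightarrow> 0"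
    by (auto intro: tendsto_mult_right_zero)
  moreover have "2 * (\<integral>x. ?i x * (1 - ?i (x + t n)) \<partial>lborel) = (\<integral>x. \<bar>?i (x + t n) - ?i x\<bar> \<partial>lborel)" for n
  proof -
    \<comment> \<open>\<open>\<bar>\<beta> - \<alpha>\<bar> = \<beta> - \<alpha> + 2 \<alpha> (1 - \<beta>)\<close> for \<open>\<alpha>, \<beta> \<in> {0, 1}\<close>, and \<open>\<beta> - \<alpha>\<close> integrates to \<open>0\<close>.\<close>
    have "(\<integral>x. \<bar>?i (x + t n) - ?i x\<bar> \<partial>lborel) =
        (\<integral>x. ?i (x + t n) - ?i x + 2 * (?i x * (1 - ?i (x + t n))) \<partial>lborel)"
      by (rule Bochner_Integration.integral_cong) (auto simp: indicator_def)
    also have "\<dots> = (\<integral>x. ?i (x + t n) \<partial>lborel) - (\<integral>x. ?i x \<partial>lborel) + 2 * (\<integral>x. ?i x * (1 - ?i (x + t n)) \<partial>lborel)"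
      using i i2[of n] integrable_translate[OF i, of "t n"]
      by (subst Bochner_Integration.integral_add) (auto simp del: integral_indicator)
    also have "(\<integral>x. ?i (x + t n) \<partial>lborel) = (\<integral>x. ?i x \<partial>lborel)"
      by (rule integral_translate) simp
    finally show ?thesis by simp
  qed
  ultimately show ?thesis by simp
qed

text \<open>Outer regularity reduces indicators of measurable sets to indicators of open sets; the rest is
  approximation by simple functions.\<close>
lemma L1_translation:
  fixes f :: "'a::euclidean_space \<Rightarrow> real"
  assumes f: "integrable lborel f" and t: "t \<longlonglongrightarrow> 0"
  shows "(\<lambda>n. \<integral>x. \<bar>f (x + t n) - f x\<bar> \<partial>lborel) \<longlonglongrightarrow> 0"
  using f
proof (induction rule: integrable_induct)
  case (base A c)
  then have A[measurable]: "A \<in> sets borel" by simp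
  have "(\<lambda>n. \<integral>x. \<bar>indicator A (x + t n) - indicator A x :: real\<bar> \<partial>lborel) \<longlonglongrightarrow> 0"
  proof (rule L1_translation_approx)
    show iA: "integrable lborel (indicator A :: 'a \<Rightarrow> real)" using base by simp
    fix e :: real
    assume "e > 0"
    then obtain U where U: "open U" "A \<subseteq> U" and UA: "emeasure lborel (U - A) < e"
      by (rule outer_regular_lborel[OF A])
    have [measurable]: "U \<in> sets borel" using U by simp
    have "emeasure lborel U = emeasure lborel A + emeasure lborel (U - A)"
      using U by (subst plus_emeasure) (auto simp: Un_absorb1)
    also have "\<dots> < \<infinity>" using base UA by (auto simp: less_top[symmetric] ennreal_add_eq_top)
    finally have fin: "emeasure lborel U < \<infinity>" .
    have "(\<integral>x. \<bar>indicator A x - indicator U x :: real\<bar> \<partial>lborel) = (\<integral>x. indicator (U - A) x \<partial>lborel)"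
      using U by (intro Bochner_Integration.integral_cong) (auto simp: indicator_def)
    also have "\<dots> = measure lborel (U - A)" by simp
    also have "\<dots> < e"
    proof -
      have "emeasure lborel (U - A) = ennreal (measure lborel (U - A))"
        using UA by (intro emeasure_eq_ennreal_measure) auto
      with UA show ?thesis by (simp add: ennreal_less_iff)
    qed
    finally show "\<exists>g. integrable lborel g \<and> (\<integral>x. \<bar>indicator A x - g x\<bar> \<partial>lborel) < e \<and>
         (\<lambda>n. \<integral>x. \<bar>g (x + t n) - g x\<bar> \<partial>lborel) \<longlonglongrightarrow> 0"
      using L1_translation_open[OF U(1) fin t] fin by (intro exI[of _ "indicator U"]) simp
  qed
  then have "(\<lambda>n. (\<integral>x. \<bar>indicator A (x + t n) - indicator A x :: real\<bar> \<partial>lborel) * \<bar>c\<bar>) \<longlonglongrightarrow> 0"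
    by (rule tendsto_mult_left_zero)
  then show ?case
    by (simp add: abs_mult flip: left_diff_distrib)
next
  case (add f g)
  have le: "(\<integral>x. \<bar>f (x + t n) + g (x + t n) - (f x + g x)\<bar> \<partial>lborel)
      \<le> (\<integral>x. \<bar>f (x + t n) - f x\<bar> \<partial>lborel) + (\<integral>x. \<bar>g (x + t n) - g x\<bar> \<partial>lborel)" for n
  proof -
    have "(\<integral>x. \<bar>f (x + t n) + g (x + t n) - (f x + g x)\<bar> \<partial>lborel)
        \<le> (\<integral>x. \<bar>f (x + t n) - f x\<bar> + \<bar>g (x + t n) - g x\<bar> \<partial>lborel)"
      using add.hyps integrable_translate[of f "t n"] integrable_translate[of g "t n"]
      by (intro integral_mono) auto
    also have "\<dots> = (\<integral>x. \<bar>f (x + t n) - f x\<bar> \<partial>lborel) + (\<integral>x. \<bar>g (x + t n) - g x\<bar> \<partial>lborel)"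
      using add.hyps integrable_translate[of f "t n"] integrable_translate[of g "t n"] by simp
    finally show ?thesis .
  qed
  have lim: "(\<lambda>n. (\<integral>x. \<bar>f (x + t n) - f x\<bar> \<partial>lborel) + (\<integral>x. \<bar>g (x + t n) - g x\<bar> \<partial>lborel)) \<longlonglongrightarrow> 0"
    using tendsto_add[OF add.IH] by simp
  show ?case
    by (rule tendsto_sandwich[OF _ always_eventually[OF allI[OF le]] tendsto_const lim]) simp
next
  case (lim f s)
  show ?case
  proof (rule L1_translation_approx[OF lim.hyps(4)])
    fix e :: real
    assume "e > 0"
    have [measurable]: "f \<in> borel_measurable borel" "\<And>i. s i \<in> borel_measurable borel"
      using lim.hyps by auto
    have "(\<lambda>i. \<integral>x. \<bar>f x - s i x\<bar> \<partial>lborel) \<longlonglongrightarrow> (\<integral>x. 0 \<partial>(lborel :: 'a measure))"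
    proof (rule integral_dominated_convergence[where w = "\<lambda>x. 3 * \<bar>f x\<bar>"])
      show "integrable lborel (\<lambda>x. 3 * \<bar>f x\<bar>)" using lim.hyps by simp
      show "AE x in lborel. (\<lambda>i. \<bar>f x - s i x\<bar>) \<longlonglongrightarrow> 0"
      proof (intro AE_I2)
        fix x
        have "(\<lambda>i. \<bar>f x - s i x\<bar>) \<longlonglongrightarrow> \<bar>f x - f x\<bar>"
          by (intro tendsto_intros lim.hyps) simp
        then show "(\<lambda>i. \<bar>f x - s i x\<bar>) \<longlonglongrightarrow> 0" by simp
      qed
      show "AE x in lborel. norm \<bar>f x - s i x\<bar> \<le> 3 * \<bar>f x\<bar>" for i
      proof (intro AE_I2)
        fix x
        show "norm \<bar>f x - s i x\<bar> \<le> 3 * \<bar>f x\<bar>" using lim.hyps(3)[of x i] by simp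
      qed
    qed auto
    then have "\<forall>\<^sub>F i in sequentially. (\<integral>x. \<bar>f x - s i x\<bar> \<partial>lborel) < e"
      using \<open>e > 0\<close> order_tendstoD(2) by fastforce
    then obtain i where "(\<integral>x. \<bar>f x - s i x\<bar> \<partial>lborel) < e"
      by (auto simp: eventually_sequentially)
    then show "\<exists>g. integrable lborel g \<and> (\<integral>x. \<bar>f x - g x\<bar> \<partial>lborel) < e \<and>
         (\<lambda>n. \<integral>x. \<bar>g (x + t n) - g x\<bar> \<partial>lborel) \<longlonglongrightarrow> 0"
      using lim.hyps(1) lim.IH by blast
  qed
qed

section \<open>Convergence of difference quotients\<close>

text \<open>The difference quotient is the mean of \<open>g\<close> over a segment, so its \<open>L\<^sup>1\<close> distance to \<open>g\<close> is at
  most the mean over the segment of the \<open>L\<^sup>1\<close> distances between \<open>g\<close> and its translates.\<close>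
lemma difference_quotients_L1:
  fixes f g :: "real^'m::finite \<Rightarrow> real" and k :: 'm and h :: "nat \<Rightarrow> real"
    and p q :: "real^'m"
  defines "e \<equiv> axis k 1"
  defines "u \<equiv> \<lambda>n x. indicator (box p q) x * ((f (x + h n *\<^sub>R e) - f x) / h n - g x)"
  assumes f: "integrable lborel f" and g: "integrable lborel g"
    and weak: "\<And>n a b. cbox a b \<subseteq> W \<Longrightarrow>
        (\<integral>x. f x * partial_deriv k (bump n a b) x \<partial>lborel) = - (\<integral>x. g x * bump n a b x \<partial>lborel)"
    and h: "h \<longlonglongrightarrow> 0" "\<And>n. h n \<noteq> 0"
    and sub: "\<And>n s. 0 \<le> s \<Longrightarrow> s \<le> 1 \<Longrightarrow>
        cbox (p + s *\<^sub>R h n *\<^sub>R e) (q + s *\<^sub>R h n *\<^sub>R e) \<subseteq> W"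
  shows "integrable lborel (u n)" and "(\<lambda>n. \<integral>x. \<bar>u n x\<bar> \<partial>lborel) \<longlonglongrightarrow> 0"
proof -
  have [measurable]: "f \<in> borel_measurable borel" "g \<in> borel_measurable borel" using f g by auto
  show iu: "integrable lborel (u n)" for n
  proof -
    have "integrable lborel (\<lambda>x. (f (x + h n *\<^sub>R e) - f x) / h n - g x)"
      using f g integrable_translate[OF f, of "h n *\<^sub>R e"] by simp
    from integrable_mult_indicator[OF _ this, of "box p q"] show ?thesis by (simp add: u_def)
  qed
  define \<omega> where "\<omega> n s = indicator {0..1} s * (\<integral>x. \<bar>g (x + s *\<^sub>R h n *\<^sub>R e) - g x\<bar> \<partial>lborel)" for n and s :: real
  have int: "integrable (lborel \<Otimes>\<^sub>M lborel)
      (\<lambda>(s::real, x). indicator {0..1} s * \<bar>g (x + s *\<^sub>R h n *\<^sub>R e) - g x\<bar>)" for n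
  proof -
    have "integrable (lborel \<Otimes>\<^sub>M lborel) (\<lambda>y.
       \<bar>(\<lambda>(s::real, x). indicator {0..1} s * g (x + s *\<^sub>R h n *\<^sub>R e)) y -
        (\<lambda>(s::real, x). indicator {0..1} s * g x) y\<bar>)"
      using integrable_sweep[OF g, of "h n *\<^sub>R e"] integrable_sweep[OF g, of 0]
      by (intro integrable_abs Bochner_Integration.integrable_diff) simp_all
    then show ?thesis
      by (rule Bochner_Integration.integrable_cong[THEN iffD1, rotated 2])
         (auto simp: abs_mult simp flip: right_diff_distrib)
  qed
  have \<omega>_le: "(\<integral>x. \<bar>u n x\<bar> \<partial>lborel) \<le> (\<integral>s. \<omega> n s \<partial>lborel)" for n
  proof -
    have "(\<integral>x. \<bar>u n x\<bar> \<partial>lborel) \<le>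
      (\<integral>x. (\<integral>s. indicator {0..1} s * \<bar>g (x + s *\<^sub>R h n *\<^sub>R e) - g x\<bar> \<partial>lborel) \<partial>lborel)"
    proof (rule integral_mono_AE)
      show "integrable lborel (\<lambda>x. \<bar>u n x\<bar>)" using iu by simp
      show "integrable lborel (\<lambda>x. \<integral>s. indicator {0..1} s * \<bar>g (x + s *\<^sub>R h n *\<^sub>R e) - g x\<bar> \<partial>lborel)"
        by (rule lborel_pair.integrable_snd[OF int])
      have inc: "AE x in lborel. x \<in> box p q \<longrightarrow> f (x + h n *\<^sub>R e) - f x =
          h n * (\<integral>s. indicator {0..1} s * g (x + s *\<^sub>R h n *\<^sub>R e) \<partial>lborel)"
        unfolding e_def by (rule weak_increment[OF f g weak sub[unfolded e_def]])
      show "AE x in lborel. \<bar>u n x\<bar> \<le> (\<integral>s. indicator {0..1} s * \<bar>g (x + s *\<^sub>R h n *\<^sub>R e) - g x\<bar> \<partial>lborel)"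
        using inc lborel_pair.AE_integrable_snd[OF integrable_sweep[OF g, of "h n *\<^sub>R e"]]
      proof eventually_elim
        case (elim x)
        show ?case
        proof (cases "x \<in> box p q")
          case True
          let ?G = "\<integral>s. indicator {0..1} s * g (x + s *\<^sub>R h n *\<^sub>R e) \<partial>lborel"
          have "u n x = ?G - g x" using elim(1) True h(2)[of n] by (simp add: u_def)
          also have "\<dots> = (\<integral>s. indicator {0..1} s * g (x + s *\<^sub>R h n *\<^sub>R e) - indicator {0..1} s * g x \<partial>lborel)"
            using elim(2) by (subst Bochner_Integration.integral_diff) simp_all
          also have "\<bar>\<dots>\<bar> \<le> (\<integral>s. \<bar>indicator {0..1} s * g (x + s *\<^sub>R h n *\<^sub>R e) - indicator {0..1} s * g x\<bar> \<partial>lborel)"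
            by (rule integral_abs_bound)
          also have "\<dots> = (\<integral>s. indicator {0..1} s * \<bar>g (x + s *\<^sub>R h n *\<^sub>R e) - g x\<bar> \<partial>lborel)"
            by (simp add: abs_mult flip: right_diff_distrib)
          finally show ?thesis by simp
        next
          case False
          then show ?thesis by (simp add: u_def integral_nonneg_AE)
        qed
      qed
    qed
    also have "\<dots> = (\<integral>s. (\<integral>x. indicator {0..1} s * \<bar>g (x + s *\<^sub>R h n *\<^sub>R e) - g x\<bar> \<partial>lborel) \<partial>lborel)"
      by (rule lborel_pair.Fubini_integral[OF int])
    also have "\<dots> = (\<integral>s. \<omega> n s \<partial>lborel)" by (simp add: \<omega>_def)
    finally show ?thesis .
  qed
  have "(\<lambda>n. \<integral>s. \<omega> n s \<partial>lborel) \<longlonglongrightarrow> (\<integral>s. 0 \<partial>(lborel :: real measure))"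
  proof (rule integral_dominated_convergence[where w = "\<lambda>s. indicator {0..1} s * (2 * (\<integral>x. \<bar>g x\<bar> \<partial>lborel))"])
    show "\<omega> n \<in> borel_measurable lborel" for n
      unfolding \<omega>_def using borel_measurable_integrable[OF lborel_pair.integrable_fst[OF int[of n]]]
      by simp
    show "integrable lborel (\<lambda>s::real. indicator {0..1} s * (2 * (\<integral>x. \<bar>g x\<bar> \<partial>lborel)))" by simp
    show "AE s in lborel. (\<lambda>n. \<omega> n s) \<longlonglongrightarrow> 0"
    proof (intro AE_I2)
      fix s :: real
      have "(\<lambda>n. s *\<^sub>R h n *\<^sub>R e) \<longlonglongrightarrow> s *\<^sub>R 0 *\<^sub>R e" by (intro tendsto_intros h)
      then show "(\<lambda>n. \<omega> n s) \<longlonglongrightarrow> 0"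
        unfolding \<omega>_def by (intro tendsto_mult_right_zero L1_translation[OF g]) simp
    qed
    fix n
    have "(\<integral>x. \<bar>g (x + d) - g x\<bar> \<partial>lborel) \<le> 2 * (\<integral>x. \<bar>g x\<bar> \<partial>lborel)" for d
    proof -
      have "(\<integral>x. \<bar>g (x + d) - g x\<bar> \<partial>lborel) \<le> (\<integral>x. \<bar>g (x + d)\<bar> + \<bar>g x\<bar> \<partial>lborel)"
        using g integrable_translate[OF g, of d] by (intro integral_mono) auto
      also have "\<dots> = (\<integral>x. \<bar>g (x + d)\<bar> \<partial>lborel) + (\<integral>x. \<bar>g x\<bar> \<partial>lborel)"
        using g integrable_translate[OF g, of d] by simp
      also have "(\<integral>x. \<bar>g (x + d)\<bar> \<partial>lborel) = (\<integral>x. \<bar>g x\<bar> \<partial>lborel)"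
        by (rule integral_translate) simp
      finally show ?thesis by simp
    qed
    then show "AE s in lborel. norm (\<omega> n s) \<le> indicator {0..1} s * (2 * (\<integral>x. \<bar>g x\<bar> \<partial>lborel))"
      unfolding \<omega>_def by (intro AE_I2) (auto simp: indicator_def)
  qed auto
  then have lim0: "(\<lambda>n. \<integral>s. \<omega> n s \<partial>lborel) \<longlonglongrightarrow> 0" by simp
  show "(\<lambda>n. \<integral>x. \<bar>u n x\<bar> \<partial>lborel) \<longlonglongrightarrow> 0"
    by (rule tendsto_sandwich[OF _ always_eventually[OF allI[OF \<omega>_le]] tendsto_const lim0]) simp
qed

text \<open>Passing to the subsequence once, for the sum of all errors, yields a common sequence for the
  whole family; products of its members can be differentiated only along a common sequence.\<close>
lemma difference_quotients_AE:
  fixes f g :: "'i::finite \<Rightarrow> real^'m::finite \<Rightarrow> real" and k :: 'm and h :: "nat \<Rightarrow> real"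
  defines "e \<equiv> axis k 1"
  assumes f: "\<And>i. integrable lborel (f i)" and g: "\<And>i. integrable lborel (g i)"
    and weak: "\<And>i n a b. cbox a b \<subseteq> W \<Longrightarrow>
        (\<integral>x. f i x * partial_deriv k (bump n a b) x \<partial>lborel) = - (\<integral>x. g i x * bump n a b x \<partial>lborel)"
    and h: "h \<longlonglongrightarrow> 0" "\<And>n. h n \<noteq> 0"
    and sub: "\<And>n s. 0 \<le> s \<Longrightarrow> s \<le> 1 \<Longrightarrow>
        cbox (p + s *\<^sub>R h n *\<^sub>R e) (q + s *\<^sub>R h n *\<^sub>R e) \<subseteq> W"
  shows "\<exists>r. strict_mono r \<and> (AE x in lborel. x \<in> box p q \<longrightarrow>
           (\<forall>i. (\<lambda>n. (f i (x + h (r n) *\<^sub>R e) - f i x) / h (r n)) \<longlonglongrightarrow> g i x))"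
proof -
  define u where "u i n x = indicator (box p q) x * ((f i (x + h n *\<^sub>R e) - f i x) / h n - g i x)" for i n x
  note L1 = difference_quotients_L1[OF f g weak h sub[unfolded e_def], folded e_def, folded u_def]
  have "\<exists>r. strict_mono r \<and> (AE x in lborel. (\<lambda>n. \<Sum>i\<in>UNIV. \<bar>u i (r n) x\<bar>) \<longlonglongrightarrow> 0)"
  proof (rule tendsto_L1_AE_subseq)
    show "integrable lborel (\<lambda>x. \<Sum>i\<in>UNIV. \<bar>u i n x\<bar>)" for n using L1(1) by simp
    have "(\<lambda>n. \<Sum>i\<in>UNIV. \<integral>x. \<bar>u i n x\<bar> \<partial>lborel) \<longlonglongrightarrow> (\<Sum>i\<in>(UNIV::'i set). 0)"
      by (intro tendsto_sum L1(2))
    then show "(\<lambda>n. \<integral>x. norm (\<Sum>i\<in>UNIV. \<bar>u i n x\<bar>) \<partial>lborel) \<longlonglongrightarrow> 0"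
      using L1(1) by (simp add: sum_nonneg)
  qed
  then obtain r where r: "strict_mono r"
    and ae: "AE x in lborel. (\<lambda>n. \<Sum>i\<in>UNIV. \<bar>u i (r n) x\<bar>) \<longlonglongrightarrow> 0" by blast
  have "AE x in lborel. x \<in> box p q \<longrightarrow>
           (\<forall>i. (\<lambda>n. (f i (x + h (r n) *\<^sub>R e) - f i x) / h (r n)) \<longlonglongrightarrow> g i x)"
    using ae
  proof eventually_elim
    case (elim x)
    show ?case
    proof (intro impI allI)
      fix i
      assume x: "x \<in> box p q"
      have "(\<lambda>n. \<bar>u i (r n) x\<bar>) \<longlonglongrightarrow> 0"
        by (rule tendsto_sandwich[OF _ _ tendsto_const elim])
           (auto intro!: always_eventually member_le_sum)
      then have "(\<lambda>n. u i (r n) x) \<longlonglongrightarrow> 0" by (simp only: tendsto_rabs_zero_iff)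
      then show "(\<lambda>n. (f i (x + h (r n) *\<^sub>R e) - f i x) / h (r n)) \<longlonglongrightarrow> g i x"
        using x by (simp add: u_def LIM_zero_iff)
    qed
  qed
  with r show ?thesis by blast
qed

text \<open>Restricting the test functions to bumps makes the symmetry of second weak derivatives an
  instance of \<open>smooth_alg_partial_deriv_commute\<close>.\<close>
definition weak_deriv_on_bumps ::
  "(real^'m::finite) set \<Rightarrow> 'm \<Rightarrow> (real^'m \<Rightarrow> real) \<Rightarrow> (real^'m \<Rightarrow> real) \<Rightarrow> bool" where
  "weak_deriv_on_bumps \<Omega> k f g \<longleftrightarrow>
     locally_integrable_on f \<Omega> \<and> locally_integrable_on g \<Omega> \<and>
     (\<forall>n a b. cbox a b \<subseteq> \<Omega> \<longrightarrow>
        set_lebesgue_integral lebesgue \<Omega> (\<lambda>x. f x * partial_deriv k (bump n a b) x) =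
        - set_lebesgue_integral lebesgue \<Omega> (\<lambda>x. g x * bump n a b x))"

lemma has_weak_deriv_imp_on_bumps:
  assumes "has_weak_deriv \<Omega> [k] f g"
  shows "weak_deriv_on_bumps \<Omega> k f g"
proof -
  have "test_function \<Omega> (bump n a b)" if "cbox a b \<subseteq> \<Omega>" for n a b
    by (rule test_function_smooth_alg[OF smooth_alg_bump bump_eq_0_cbox that])
  with assms show ?thesis
    unfolding weak_deriv_on_bumps_def has_weak_deriv_def by (simp add: iterated_partial_def)
qed

text \<open>Either order of differentiation in \<open>H\<close> will do, because the derivatives of a bump commute and
  \<open>\<partial>\<^sub>k\<close> of a bump is itself a test function for \<open>u\<close>.\<close>
lemma second_weak_deriv_on_bumps:
  assumes ui: "has_weak_deriv \<Omega> [i] u ui"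
    and H: "has_weak_deriv \<Omega> [i, k] u H \<or> has_weak_deriv \<Omega> [k, i] u H"
  shows "weak_deriv_on_bumps \<Omega> k ui H"
  unfolding weak_deriv_on_bumps_def
proof (intro conjI allI impI)
  show "locally_integrable_on ui \<Omega>" using ui by (simp add: has_weak_deriv_def)
  show "locally_integrable_on H \<Omega>" using H by (auto simp: has_weak_deriv_def)
  fix n and a b :: "real^'a"
  assume ab: "cbox a b \<subseteq> \<Omega>"
  let ?\<phi> = "bump n a b"
  have comm: "partial_deriv k (partial_deriv i ?\<phi>) = partial_deriv i (partial_deriv k ?\<phi>)"
    by (rule smooth_alg_partial_deriv_commute[OF smooth_alg_bump])
  have t: "test_function \<Omega> ?\<phi>" "test_function \<Omega> (partial_deriv k ?\<phi>)"
    using ab by (auto intro!: test_function_smooth_alg smooth_alg_partial_deriv smooth_alg_bump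
        simp: bump_eq_0_cbox partial_deriv_bump_eq_0)
  have "set_lebesgue_integral lebesgue \<Omega> (\<lambda>x. u x * partial_deriv i (partial_deriv k ?\<phi>) x) =
      - set_lebesgue_integral lebesgue \<Omega> (\<lambda>x. ui x * partial_deriv k ?\<phi> x)"
    using ui t(2) by (auto simp: has_weak_deriv_def iterated_partial_def)
  moreover have "set_lebesgue_integral lebesgue \<Omega> (\<lambda>x. u x * partial_deriv i (partial_deriv k ?\<phi>) x) =
      set_lebesgue_integral lebesgue \<Omega> (\<lambda>x. H x * ?\<phi> x)"
    using H t(1) comm by (auto simp: has_weak_deriv_def iterated_partial_def)
  ultimately show "set_lebesgue_integral lebesgue \<Omega> (\<lambda>x. ui x * partial_deriv k ?\<phi> x) =
      - set_lebesgue_integral lebesgue \<Omega> (\<lambda>x. H x * ?\<phi> x)" by simp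
qed

lemma AE_lborel_translate:
  assumes "AE x in lborel. P x"
  shows "AE x in lborel. P (x + d :: 'a::euclidean_space)"
proof -
  have "AE x in distr lborel borel ((+) d). P x" unfolding lborel_distr_plus by (rule assms)
  from AE_distrD[OF _ this] show ?thesis by (simp add: add.commute)
qed

text \<open>Cutting off outside a compact box and choosing a Borel representative leads from locally
  Lebesgue-integrable functions on \<open>\<Omega>\<close> to globally integrable Borel functions, for which
  translations and Fubini's theorem are available.\<close>
lemma locally_integrable_truncation:
  assumes "locally_integrable_on f \<Omega>" "cbox A B \<subseteq> \<Omega>"
  shows "\<exists>f'. integrable lborel f' \<and> (AE x in lborel. f' x = indicator (cbox A B) x * f x)"
proof -
  have int: "integrable lebesgue (\<lambda>x. indicator (cbox A B) x * f x)"
    using assms by (simp add: locally_integrable_on_def set_integrable_def)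
  then obtain f' where f'[measurable]: "f' \<in> borel_measurable lborel"
    and ae: "AE x in lborel. indicator (cbox A B) x * f x = f' x"
    using completion_ex_borel_measurable_real[OF borel_measurable_integrable] by blast
  have "integrable lebesgue f'"
    using int
    by (rule integrable_cong_AE_imp)
       (use ae f' in \<open>auto simp: AE_completion_iff measurable_completion\<close>)
  then have "integrable lborel f'" by (simp add: integrable_completion)
  then show ?thesis using ae by (intro exI[of _ f']) (auto elim: eventually_mono)
qed

lemma integral_truncation:
  fixes f f' \<psi> :: "'a::euclidean_space \<Rightarrow> real"
  assumes f': "integrable lborel f'" and ae: "AE x in lborel. f' x = indicator (cbox A B) x * f x"
    and sub: "cbox A B \<subseteq> \<Omega>"
    and \<psi>: "continuous_on UNIV \<psi>" "\<And>x. x \<notin> cbox A B \<Longrightarrow> \<psi> x = 0"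
  shows "set_lebesgue_integral lebesgue \<Omega> (\<lambda>x. f x * \<psi> x) = (\<integral>x. f' x * \<psi> x \<partial>lborel)"
proof -
  have [measurable]: "f' \<in> borel_measurable borel" "\<psi> \<in> borel_measurable borel"
    using f' \<psi> by (auto intro: borel_measurable_continuous_onI)
  have m: "(\<lambda>x. f' x * \<psi> x) \<in> borel_measurable lborel" by measurable
  have ae': "AE x in lebesgue. f' x * \<psi> x = indicator \<Omega> x *\<^sub>R (f x * \<psi> x)"
    unfolding AE_completion_iff using ae
  proof eventually_elim
    case (elim x)
    then show ?case using sub \<psi>(2)[of x] by (auto simp: indicator_def)
  qed
  have m': "(\<lambda>x. indicator \<Omega> x *\<^sub>R (f x * \<psi> x)) \<in> borel_measurable lebesgue"
    by (rule borel_measurable_AE[OF _ ae']) (use m in \<open>simp add: measurable_completion\<close>)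
  have "(\<integral>x. f' x * \<psi> x \<partial>lborel) = (\<integral>x. f' x * \<psi> x \<partial>lebesgue)"
    by (rule integral_completion[symmetric, OF m])
  also have "\<dots> = set_lebesgue_integral lebesgue \<Omega> (\<lambda>x. f x * \<psi> x)"
    unfolding set_lebesgue_integral_def
    by (rule integral_cong_AE[OF _ m' ae']) (use m in \<open>simp add: measurable_completion\<close>)
  finally show ?thesis ..
qed

text \<open>The box \<open>box p q\<close> is half as large as a box \<open>box A B\<close> around \<open>x0\<close>; the steps \<open>h n\<close> are bounded
  by the gap between them in direction \<open>k\<close>, so the translates of \<open>box p q\<close> remain inside the
  region on which the truncation changes nothing.\<close>
lemma local_difference_quotients:
  fixes f g :: "'i::finite \<Rightarrow> real^'m::finite \<Rightarrow> real" and k :: 'm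
  assumes \<Omega>: "open \<Omega>" "x0 \<in> \<Omega>"
    and weak: "\<And>i. weak_deriv_on_bumps \<Omega> k (f i) (g i)"
  shows "\<exists>p q. \<exists>h :: nat \<Rightarrow> real. x0 \<in> box p q \<and> h \<longlonglongrightarrow> 0 \<and> (\<forall>n. h n \<noteq> 0) \<and>
    (\<forall>x\<in>box p q. x \<in> \<Omega> \<and> (\<forall>n. x + h n *\<^sub>R axis k 1 \<in> \<Omega>)) \<and>
    (AE x in lborel. x \<in> box p q \<longrightarrow>
       (\<forall>i. (\<lambda>n. (f i (x + h n *\<^sub>R axis k 1) - f i x) / h n) \<longlonglongrightarrow> g i x))"
proof -
  obtain A B where AB: "cbox A B \<subseteq> \<Omega>" "x0 \<in> box A B" "\<forall>i\<in>Basis. A \<bullet> i < B \<bullet> i"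
    by (rule open_contains_cbox[OF \<Omega>])
  define p where "p = (1/2) *\<^sub>R (A + x0)"
  define q where "q = (1/2) *\<^sub>R (B + x0)"
  define \<delta> where "\<delta> = (B $ k - x0 $ k) / 2"
  define h where "h n = \<delta> * inverse (real (Suc n))" for n
  have \<delta>: "\<delta> > 0" using AB(2) by (simp add: \<delta>_def mem_box_cart)
  have h_pos: "h n > 0" for n using \<delta> by (simp add: h_def)
  have h_le: "h n \<le> \<delta>" for n using \<delta> by (simp add: h_def field_simps)
  have "h \<longlonglongrightarrow> \<delta> * 0" unfolding h_def by (intro tendsto_intros LIMSEQ_inverse_real_of_nat)
  then have h0: "h \<longlonglongrightarrow> 0" by simp
  have x0: "x0 \<in> box p q" using AB(2) by (auto simp: mem_box_cart p_def q_def field_simps)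
  have sub: "cbox (p + s *\<^sub>R h n *\<^sub>R axis k 1) (q + s *\<^sub>R h n *\<^sub>R axis k 1) \<subseteq> cbox A B"
    if s: "0 \<le> s" "s \<le> 1" for s n
  proof
    fix x
    assume x: "x \<in> cbox (p + s *\<^sub>R h n *\<^sub>R axis k 1) (q + s *\<^sub>R h n *\<^sub>R axis k 1)"
    have "s * h n \<le> 1 * h n" using s h_pos[of n] by (intro mult_right_mono) auto
    then have sh: "0 \<le> s * h n" "s * h n \<le> \<delta>"
      using s h_pos[of n] h_le[of n] by (simp, linarith)
    have "A $ i \<le> x $ i \<and> x $ i \<le> B $ i" for i
    proof -
      define t where "t = s * (h n * axis k 1 $ i)"
      have "A $ i < x0 $ i" "x0 $ i < B $ i" using AB(2) by (auto simp: mem_box_cart)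
      moreover have "p $ i + t \<le> x $ i"
        "x $ i \<le> q $ i + t"
        using x by (simp_all add: mem_box_cart mult.assoc t_def)
      moreover have "p $ i = (A $ i + x0 $ i) / 2" "q $ i = (B $ i + x0 $ i) / 2"
        by (simp_all add: p_def q_def)
      moreover have "0 \<le> t" "t \<le> (B $ i - x0 $ i) / 2"
        using sh \<open>x0 $ i < B $ i\<close> by (auto simp: t_def axis_def \<delta>_def)
      ultimately show ?thesis by argo
    qed
    then show "x \<in> cbox A B" by (simp add: mem_box_cart)
  qed
  have pq: "x \<in> cbox A B" "x + h n *\<^sub>R axis k 1 \<in> cbox A B" if "x \<in> box p q" for x n
  proof -
    have x: "x \<in> cbox p q" using that box_subset_cbox[of p q] by auto
    have "cbox p q \<subseteq> cbox A B" using sub[of 0 0, OF order_refl zero_le_one] by simp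
    then show "x \<in> cbox A B" using x by (rule subsetD)
    have "x + h n *\<^sub>R axis k 1 \<in> cbox (p + 1 *\<^sub>R h n *\<^sub>R axis k 1) (q + 1 *\<^sub>R h n *\<^sub>R axis k 1)"
      using x by (simp add: mem_box_cart)
    then show "x + h n *\<^sub>R axis k 1 \<in> cbox A B"
      by (rule subsetD[OF sub[of 1 n, OF zero_le_one order_refl]])
  qed
  have li: "locally_integrable_on (f i) \<Omega>" "locally_integrable_on (g i) \<Omega>" for i
    using weak[of i] by (auto simp: weak_deriv_on_bumps_def)
  have "\<forall>i. \<exists>f'. integrable lborel f' \<and> (AE x in lborel. f' x = indicator (cbox A B) x * f i x)"
    by (intro allI locally_integrable_truncation[OF li(1) AB(1)])
  then obtain f' where f': "\<And>i. integrable lborel (f' i)"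
    and f'_ae: "\<And>i. AE x in lborel. f' i x = indicator (cbox A B) x * f i x"
    unfolding choice_iff by blast
  have "\<forall>i. \<exists>g'. integrable lborel g' \<and> (AE x in lborel. g' x = indicator (cbox A B) x * g i x)"
    by (intro allI locally_integrable_truncation[OF li(2) AB(1)])
  then obtain g' where g': "\<And>i. integrable lborel (g' i)"
    and g'_ae: "\<And>i. AE x in lborel. g' i x = indicator (cbox A B) x * g i x"
    unfolding choice_iff by blast
  have weak': "(\<integral>x. f' i x * partial_deriv k (bump n a b) x \<partial>lborel) = - (\<integral>x. g' i x * bump n a b x \<partial>lborel)"
    if ab: "cbox a b \<subseteq> cbox A B" for i n a b
  proof -
    have "(\<integral>x. f' i x * partial_deriv k (bump n a b) x \<partial>lborel) =
        set_lebesgue_integral lebesgue \<Omega> (\<lambda>x. f i x * partial_deriv k (bump n a b) x)"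
      using ab
      by (intro integral_truncation[OF f' f'_ae AB(1), symmetric] smooth_alg_continuous
          smooth_alg_partial_deriv smooth_alg_bump partial_deriv_bump_eq_0) auto
    also have "\<dots> = - set_lebesgue_integral lebesgue \<Omega> (\<lambda>x. g i x * bump n a b x)"
      using weak[of i] ab AB(1) by (simp add: weak_deriv_on_bumps_def)
    also have "set_lebesgue_integral lebesgue \<Omega> (\<lambda>x. g i x * bump n a b x) = (\<integral>x. g' i x * bump n a b x \<partial>lborel)"
      using ab
      by (intro integral_truncation[OF g' g'_ae AB(1)] smooth_alg_continuous
          smooth_alg_bump bump_eq_0_cbox) auto
    finally show ?thesis .
  qed
  have hn0: "h n \<noteq> 0" for n using h_pos[of n] by simp
  have ex_r: "\<exists>r. strict_mono r \<and> (AE x in lborel. x \<in> box p q \<longrightarrow>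
      (\<forall>i. (\<lambda>n. (f' i (x + h (r n) *\<^sub>R axis k 1) - f' i x) / h (r n)) \<longlonglongrightarrow> g' i x))"
    by (rule difference_quotients_AE[OF f' g' weak' h0 hn0 sub])
  from ex_r obtain r where r_dq: "strict_mono r \<and> (AE x in lborel. x \<in> box p q \<longrightarrow>
      (\<forall>i. (\<lambda>n. (f' i (x + h (r n) *\<^sub>R axis k 1) - f' i x) / h (r n)) \<longlonglongrightarrow> g' i x))" ..
  note r = r_dq[THEN conjunct1] and dq = r_dq[THEN conjunct2]
  show ?thesis
  proof (rule exI[of _ p], rule exI[of _ q], rule exI[of _ "h \<circ> r"], intro conjI)
    show "(h \<circ> r) \<longlonglongrightarrow> 0" using h0 r by (rule LIMSEQ_subseq_LIMSEQ)
    have f'_ae': "AE x in lborel. \<forall>i. f' i x = indicator (cbox A B) x * f i x"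
      by (simp only: AE_all_countable f'_ae simp_thms)
    have "AE x in lborel. \<forall>i. f' i (x + h n *\<^sub>R axis k 1) =
        indicator (cbox A B) (x + h n *\<^sub>R axis k 1) * f i (x + h n *\<^sub>R axis k 1)" for n
      by (rule AE_lborel_translate[OF f'_ae'])
    then have "AE x in lborel. \<forall>n. \<forall>i. f' i (x + h n *\<^sub>R axis k 1) =
        indicator (cbox A B) (x + h n *\<^sub>R axis k 1) * f i (x + h n *\<^sub>R axis k 1)"
      by (simp only: AE_all_countable simp_thms)
    moreover have "AE x in lborel. \<forall>i. g' i x = indicator (cbox A B) x * g i x"
      by (simp only: AE_all_countable g'_ae simp_thms)
    moreover note f'_ae'
    ultimately show "AE x in lborel. x \<in> box p q \<longrightarrow>
       (\<forall>i. (\<lambda>n. (f i (x + (h \<circ> r) n *\<^sub>R axis k 1) - f i x) / (h \<circ> r) n) \<longlonglongrightarrow> g i x)"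
      using dq
    proof eventually_elim
      case (elim x)
      show ?case
      proof (intro impI allI)
        fix i
        assume x: "x \<in> box p q"
        have "f' i (x + h n *\<^sub>R axis k 1) = f i (x + h n *\<^sub>R axis k 1)" for n
          using elim(1) pq(2)[OF x] by simp
        moreover have "f' i x = f i x" "g' i x = g i x" using elim(2,3) pq(1)[OF x] by simp_all
        ultimately show "(\<lambda>n. (f i (x + (h \<circ> r) n *\<^sub>R axis k 1) - f i x) / (h \<circ> r) n) \<longlonglongrightarrow> g i x"
          using elim(4)[rule_format, OF x, of i] by (simp add: o_def)
      qed
    qed
    show "x0 \<in> box p q" by (rule x0)
    show "\<forall>n. (h \<circ> r) n \<noteq> 0" using hn0 by simp
    show "\<forall>x\<in>box p q. x \<in> \<Omega> \<and> (\<forall>n. x + (h \<circ> r) n *\<^sub>R axis k 1 \<in> \<Omega>)"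
      using subsetD[OF AB(1) pq(1)] subsetD[OF AB(1) pq(2)] by simp
  qed
qed

lemma AE_lborel_local:
  fixes \<Omega> :: "'a::euclidean_space set"
  assumes "\<And>x0. x0 \<in> \<Omega> \<Longrightarrow> \<exists>p q. x0 \<in> box p q \<and> (AE x in lborel. x \<in> box p q \<longrightarrow> P x)"
  shows "AE x in lborel. x \<in> \<Omega> \<longrightarrow> P x"
proof -
  define S where "S = {x \<in> \<Omega>. \<not> P x}"
  have "negligible S"
  proof (subst locally_negligible_alt, intro ballI)
    fix x0
    assume "x0 \<in> S"
    then obtain p q where pq: "x0 \<in> box p q" and ae: "AE x in lborel. x \<in> box p q \<longrightarrow> P x"
      using assms[of x0] by (auto simp: S_def)
    from ae obtain N where N: "N \<in> null_sets lborel" "{x \<in> space lborel. \<not> (x \<in> box p q \<longrightarrow> P x)} \<subseteq> N"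
      unfolding eventually_ae_filter by blast
    have "negligible N"
      using N(1) by (simp add: negligible_iff_null_sets null_sets_completionI)
    then have "negligible (S \<inter> box p q)"
      by (rule negligible_subset) (use N(2) in \<open>auto simp: S_def\<close>)
    moreover have "openin (top_of_set S) (S \<inter> box p q)"
      by (intro openin_open_Int open_box)
    ultimately show "\<exists>U. openin (top_of_set S) U \<and> x0 \<in> U \<and> negligible U"
      using pq \<open>x0 \<in> S\<close> by blast
  qed
  then have "AE x in lebesgue. x \<notin> S"
    by (simp add: negligible_iff_null_sets AE_not_in)
  then show ?thesis
    unfolding AE_completion_iff by (auto simp: S_def elim: eventually_mono)
qed

section \<open>Differentiating the parallelism of the two fields\<close>

text \<open>Convergence of the difference quotients forces \<open>a n \<rightarrow> a0\<close> along the same sequence, so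
  the calculus proof of the product rule applies although the functions need not be continuous.\<close>
lemma parallel_product_rule:
  fixes a b a' b' :: "nat \<Rightarrow> real" and h :: "nat \<Rightarrow> real"
  assumes h: "h \<longlonglongrightarrow> 0" "\<And>n. h n \<noteq> 0"
    and a: "(\<lambda>n. (a n - a0) / h n) \<longlonglongrightarrow> Da" and b: "(\<lambda>n. (b n - b0) / h n) \<longlonglongrightarrow> Db"
    and a': "(\<lambda>n. (a' n - a0') / h n) \<longlonglongrightarrow> Da'" and b': "(\<lambda>n. (b' n - b0') / h n) \<longlonglongrightarrow> Db'"
    and eq: "\<forall>n. a n * b n = a' n * b' n" "a0 * b0 = a0' * b0'"
  shows "Da * b0 + a0 * Db = Da' * b0' + a0' * Db'"
proof -
  have conv: "c \<longlonglongrightarrow> c0" if "(\<lambda>n. (c n - c0) / h n) \<longlonglongrightarrow> Dc" for c :: "nat \<Rightarrow> real" and c0 Dc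
  proof -
    have "(\<lambda>n. h n * ((c n - c0) / h n) + c0) \<longlonglongrightarrow> 0 * Dc + c0"
      by (intro tendsto_intros h that)
    then show ?thesis using h(2) by simp
  qed
  have product: "(\<lambda>n. (c n * d n - c0 * d0) / h n) \<longlonglongrightarrow> Dc * d0 + c0 * Dd"
    if c: "(\<lambda>n. (c n - c0) / h n) \<longlonglongrightarrow> Dc" and d: "(\<lambda>n. (d n - d0) / h n) \<longlonglongrightarrow> Dd"
    for c d :: "nat \<Rightarrow> real" and c0 d0 Dc Dd
  proof -
    have "(\<lambda>n. ((c n - c0) / h n) * d n + c0 * ((d n - d0) / h n)) \<longlonglongrightarrow> Dc * d0 + c0 * Dd"
      by (intro tendsto_intros c d conv[OF d])
    moreover have "((c n - c0) / h n) * d n + c0 * ((d n - d0) / h n) = (c n * d n - c0 * d0) / h n" for n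
      by (simp add: diff_divide_distrib algebra_simps)
    ultimately show ?thesis by simp
  qed
  show ?thesis
    using LIMSEQ_unique[OF product[OF a b]] product[OF a' b'] eq by simp
qed

text \<open>With \<open>a = \<nabla>u\<close>, \<open>b = \<nabla>v\<close> and \<open>c = F\<close> the hypothesis says that \<open>\<nabla>u + F\<close> is parallel to
  \<open>\<nabla>u - \<nabla>v\<close>, and the conclusion is its formal derivative in direction \<open>k\<close>. The parallelism also
  holds at all translates of almost every point, since the steps form a countable set.\<close>
lemma product_rule_parallel_fields:
  fixes a b c :: "'m::finite \<Rightarrow> real^'m \<Rightarrow> real"
  assumes \<Omega>: "open \<Omega>"
    and a: "\<And>i. weak_deriv_on_bumps \<Omega> k (a i) (Da i)"
    and b: "\<And>i. weak_deriv_on_bumps \<Omega> k (b i) (Db i)"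
    and c: "\<And>i. weak_deriv_on_bumps \<Omega> k (c i) (Dc i)"
    and par: "AE x in lborel. x \<in> \<Omega> \<longrightarrow>
      (\<forall>i j. (a i x + c i x) * (a j x - b j x) = (a j x + c j x) * (a i x - b i x))"
  shows "AE x in lborel. x \<in> \<Omega> \<longrightarrow> (\<forall>i j.
      (Da i x + Dc i x) * (a j x - b j x) + (a i x + c i x) * (Da j x - Db j x) =
      (Da j x + Dc j x) * (a i x - b i x) + (a j x + c j x) * (Da i x - Db i x))"
proof (rule AE_lborel_local)
  fix x0
  assume "x0 \<in> \<Omega>"
  define f where "f = case_sum a (case_sum b c)"
  define g where "g = case_sum Da (case_sum Db Dc)"
  have fg: "weak_deriv_on_bumps \<Omega> k (f i) (g i)" for i
    using a b c by (auto simp: f_def g_def split: sum.split)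
  from local_difference_quotients[where f = f and g = g, OF \<Omega> \<open>x0 \<in> \<Omega>\<close> fg]
  obtain p q h where loc: "x0 \<in> box p q \<and> h \<longlonglongrightarrow> 0 \<and> (\<forall>n. h n \<noteq> 0) \<and>
    (\<forall>x\<in>box p q. x \<in> \<Omega> \<and> (\<forall>n. x + h n *\<^sub>R axis k 1 \<in> \<Omega>)) \<and>
    (AE x in lborel. x \<in> box p q \<longrightarrow>
       (\<forall>i. (\<lambda>n. (f i (x + h n *\<^sub>R axis k 1) - f i x) / h n) \<longlonglongrightarrow> g i x))"
    by (elim exE)
  then have x0: "x0 \<in> box p q" and h: "h \<longlonglongrightarrow> 0" "\<And>n. h n \<noteq> 0"
    and in\<Omega>: "\<And>x. x \<in> box p q \<Longrightarrow> x \<in> \<Omega>" "\<And>x n. x \<in> box p q \<Longrightarrow> x + h n *\<^sub>R axis k 1 \<in> \<Omega>"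
    and dq: "AE x in lborel. x \<in> box p q \<longrightarrow>
       (\<forall>i. (\<lambda>n. (f i (x + h n *\<^sub>R axis k 1) - f i x) / h n) \<longlonglongrightarrow> g i x)"
    by blast+
  have "AE x in lborel. x + h n *\<^sub>R axis k 1 \<in> \<Omega> \<longrightarrow> (\<forall>i j.
      (a i (x + h n *\<^sub>R axis k 1) + c i (x + h n *\<^sub>R axis k 1)) *
      (a j (x + h n *\<^sub>R axis k 1) - b j (x + h n *\<^sub>R axis k 1)) =
      (a j (x + h n *\<^sub>R axis k 1) + c j (x + h n *\<^sub>R axis k 1)) *
      (a i (x + h n *\<^sub>R axis k 1) - b i (x + h n *\<^sub>R axis k 1)))" for n
    by (rule AE_lborel_translate[OF par])
  then have par': "AE x in lborel. \<forall>n. x + h n *\<^sub>R axis k 1 \<in> \<Omega> \<longrightarrow> (\<forall>i j.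
      (a i (x + h n *\<^sub>R axis k 1) + c i (x + h n *\<^sub>R axis k 1)) *
      (a j (x + h n *\<^sub>R axis k 1) - b j (x + h n *\<^sub>R axis k 1)) =
      (a j (x + h n *\<^sub>R axis k 1) + c j (x + h n *\<^sub>R axis k 1)) *
      (a i (x + h n *\<^sub>R axis k 1) - b i (x + h n *\<^sub>R axis k 1)))"
    by (subst AE_all_countable) blast
  have "AE x in lborel. x \<in> box p q \<longrightarrow> (\<forall>i j.
      (Da i x + Dc i x) * (a j x - b j x) + (a i x + c i x) * (Da j x - Db j x) =
      (Da j x + Dc j x) * (a i x - b i x) + (a j x + c j x) * (Da i x - Db i x))"
    using par par' dq
  proof eventually_elim
    case (elim x)
    show ?case
    proof (intro impI allI)
      fix i j
      assume x: "x \<in> box p q"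
      let ?y = "\<lambda>n. x + h n *\<^sub>R axis k 1"
      have d: "(\<lambda>n. (a i (?y n) - a i x) / h n) \<longlonglongrightarrow> Da i x"
        "(\<lambda>n. (b i (?y n) - b i x) / h n) \<longlonglongrightarrow> Db i x"
        "(\<lambda>n. (c i (?y n) - c i x) / h n) \<longlonglongrightarrow> Dc i x" for i
        using elim(3)[rule_format, OF x, of "Inl i"] elim(3)[rule_format, OF x, of "Inr (Inl i)"]
          elim(3)[rule_format, OF x, of "Inr (Inr i)"]
        by (simp_all add: f_def g_def)
      have ac: "(\<lambda>n. ((a i (?y n) + c i (?y n)) - (a i x + c i x)) / h n) \<longlonglongrightarrow> Da i x + Dc i x" for i
        using tendsto_add[OF d(1)[of i] d(3)[of i]]
        by (simp add: add_divide_distrib[symmetric] algebra_simps)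
      have ab: "(\<lambda>n. ((a i (?y n) - b i (?y n)) - (a i x - b i x)) / h n) \<longlonglongrightarrow> Da i x - Db i x" for i
        using tendsto_diff[OF d(1)[of i] d(2)[of i]]
        by (simp add: diff_divide_distrib[symmetric] algebra_simps)
      show "(Da i x + Dc i x) * (a j x - b j x) + (a i x + c i x) * (Da j x - Db j x) =
         (Da j x + Dc j x) * (a i x - b i x) + (a j x + c j x) * (Da i x - Db i x)"
      proof (rule parallel_product_rule[OF h ac[of i] ab[of j] ac[of j] ab[of i]])
        show "\<forall>n. (a i (?y n) + c i (?y n)) * (a j (?y n) - b j (?y n)) =
            (a j (?y n) + c j (?y n)) * (a i (?y n) - b i (?y n))"
          using elim(2) in\<Omega>(2)[OF x] by simp
        show "(a i x + c i x) * (a j x - b j x) = (a j x + c j x) * (a i x - b i x)"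
          using elim(1) in\<Omega>(1)[OF x] by simp
      qed
    qed
  qed
  with x0 show "\<exists>p q. x0 \<in> box p q \<and> (AE x in lborel. x \<in> box p q \<longrightarrow> (\<forall>i j.
      (Da i x + Dc i x) * (a j x - b j x) + (a i x + c i x) * (Da j x - Db j x) =
      (Da j x + Dc j x) * (a i x - b i x) + (a j x + c j x) * (Da i x - Db i x)))"
    by blast
qed

section \<open>The gradients agree\<close>

text \<open>Indexing the choice by the unordered pair \<open>{i, k}\<close> makes the two mixed
  derivatives literally the same function, so that they cancel pointwise later.\<close>
lemma symmetric_second_weak_derivs:
  assumes "u \<in> weakly_diff_space 2 \<Omega>"
  shows "\<exists>H. \<forall>i k. H i k = H k i \<and>
           (has_weak_deriv \<Omega> [i, k] u (H i k) \<or> has_weak_deriv \<Omega> [k, i] u (H i k))"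
proof -
  define R where "R S g \<longleftrightarrow> (\<exists>i k. S = {i, k} \<and> has_weak_deriv \<Omega> [i, k] u g)" for S g
  define H where "H i k = (SOME g. R {i, k} g)" for i k
  have R: "R {i, k} (H i k)" for i k
  proof -
    have "\<exists>g. has_weak_deriv \<Omega> [i, k] u g"
      using assms by (simp add: weakly_diff_space_def)
    then have "\<exists>g. R {i, k} g" unfolding R_def by blast
    then show ?thesis unfolding H_def by (rule someI_ex)
  qed
  have "H i k = H k i" for i k by (simp add: H_def insert_commute)
  moreover have "has_weak_deriv \<Omega> [i, k] u (H i k) \<or> has_weak_deriv \<Omega> [k, i] u (H i k)" for i k
    using R[of i k] by (auto simp: R_def doubleton_eq_iff)
  ultimately show ?thesis by blast
qed

lemma has_weak_deriv_weak_partial: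
  assumes "f \<in> weakly_diff_space n \<Omega>" "n \<ge> 1"
  shows "has_weak_deriv \<Omega> [i] f (weak_partial \<Omega> i f)"
proof -
  have "\<exists>g. has_weak_deriv \<Omega> [i] f g" using assms by (simp add: weakly_diff_space_def)
  then show ?thesis unfolding weak_partial_def by (rule someI_ex)
qed

lemma AE_lebesgue_on_iff:
  assumes "open \<Omega>"
  shows "(AE x in lebesgue_on \<Omega>. P x) \<longleftrightarrow> (AE x in lborel. x \<in> \<Omega> \<longrightarrow> P x)"
  using assms by (subst AE_restrict_space_iff) (auto simp: AE_completion_iff)

text \<open>The hypothesis is \<open>A \<and> w = 0\<close>. Dividing it by a nonzero entry \<open>w\<^sub>j\<close> writes every row of \<open>A\<close> as
  a combination of \<open>w\<close> and the \<open>j\<close>-th column.\<close>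
lemma rank_le_2_of_cyclic_identity:
  fixes A :: "real^'m^'m" and w :: "real^'m"
  assumes "w \<noteq> 0"
    and cyc: "\<And>i j k. A $ k $ i * w $ j + A $ i $ j * w $ k + A $ j $ k * w $ i = 0"
  shows "rank A \<le> 2"
proof -
  obtain j where j: "w $ j \<noteq> 0" using \<open>w \<noteq> 0\<close> by (auto simp: vec_eq_iff)
  define q where "q = (\<chi> i. A $ i $ j)"
  have "row k A = (- (w $ k / w $ j)) *\<^sub>R q + (- (A $ j $ k / w $ j)) *\<^sub>R w" for k
  proof -
    have "A $ k $ i = - (w $ k / w $ j) * A $ i $ j + - (A $ j $ k / w $ j) * w $ i" for i
    proof -
      have "A $ k $ i * w $ j = - (w $ k * A $ i $ j) - A $ j $ k * w $ i"
        using cyc[of k i j] by (simp add: algebra_simps)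
      then have "A $ k $ i = (- (w $ k * A $ i $ j) - A $ j $ k * w $ i) / w $ j"
        using j by (metis nonzero_mult_div_cancel_right)
      then show ?thesis by (simp add: diff_divide_distrib)
    qed
    then show ?thesis by (simp add: vec_eq_iff row_def q_def)
  qed
  moreover have "s *\<^sub>R q + t *\<^sub>R w \<in> span {q, w}" for s t
    by (intro span_add span_scale span_base) auto
  ultimately have "row k A \<in> span {q, w}" for k by metis
  then have "rows A \<subseteq> span {q, w}" by (auto simp: rows_def)
  then have "dim (rows A) \<le> dim {q, w}"
    by (metis dim_span dim_subset)
  also have "\<dots> \<le> card {q, w}" by (rule dim_le_card') simp
  also have "\<dots> \<le> 2" by (simp add: card_insert_if)
  finally show ?thesis by (simp add: row_rank_def)
qed

lemma equal_directions_imp_parallel: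
  fixes U V :: "real^'m"
  assumes "U /\<^sub>R norm U = V /\<^sub>R norm V"
  shows "U $ i * (U $ j - V $ j) = U $ j * (U $ i - V $ i)"
proof (cases "V = 0")
  case False
  have "V = norm V *\<^sub>R (V /\<^sub>R norm V)" using False by simp
  also have "\<dots> = (norm V / norm U) *\<^sub>R U" by (simp add: assms[symmetric] divide_inverse)
  finally have "V = (norm V / norm U) *\<^sub>R U" .
  then obtain t where "V = t *\<^sub>R U" ..
  then show ?thesis by (simp add: algebra_simps)
qed simp

theorem mainTheorem3:
  fixes \<Omega> :: "(real^'m::finite) set"
    and u v :: "real^'m \<Rightarrow> real"
    and F :: "real^'m \<Rightarrow> real^'m"
    and C :: real
  assumes "open \<Omega>" and "connected \<Omega>" and "\<Omega> \<noteq> {}"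
    and "u \<in> weakly_diff_space 2 \<Omega>" and "v \<in> weakly_diff_space 2 \<Omega>"
    and "F \<in> weakly_diff_fields 1 \<Omega>"
    and "C > 0"
    and "AE x in lebesgue_on \<Omega>. norm (weak_grad \<Omega> u x + F x) \<ge> C"
    and "AE x in lebesgue_on \<Omega>. norm (weak_grad \<Omega> v x + F x) \<ge> C"
    and "AE x in lebesgue_on \<Omega>. horizontal_normal \<Omega> F u x = horizontal_normal \<Omega> F v x"
    and "AE x in lebesgue_on \<Omega>.
           CARD('m) \<ge> rank (curl_matrix \<Omega> F x) \<and> rank (curl_matrix \<Omega> F x) \<ge> 3"
  shows "AE x in lebesgue_on \<Omega>. weak_grad \<Omega> u x = weak_grad \<Omega> v x"
proof -
  note on_iff = AE_lebesgue_on_iff[OF \<open>open \<Omega>\<close>]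
  define a where "a i = weak_partial \<Omega> i u" for i
  define b where "b i = weak_partial \<Omega> i v" for i
  define c where "c i x = F x $ i" for i x
  define D where "D k i = weak_partial \<Omega> k (c i)" for k i
  obtain H where H': "\<forall>i k. H i k = H k i \<and>
      (has_weak_deriv \<Omega> [i, k] u (H i k) \<or> has_weak_deriv \<Omega> [k, i] u (H i k))"
    using symmetric_second_weak_derivs[OF assms(4)] ..
  then have H_sym: "\<And>i k. H i k = H k i"
    and H: "\<And>i k. has_weak_deriv \<Omega> [i, k] u (H i k) \<or> has_weak_deriv \<Omega> [k, i] u (H i k)"
    by blast+
  obtain G where G': "\<forall>i k. G i k = G k i \<and>
      (has_weak_deriv \<Omega> [i, k] v (G i k) \<or> has_weak_deriv \<Omega> [k, i] v (G i k))"
    using symmetric_second_weak_derivs[OF assms(5)] ..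
  then have G_sym: "\<And>i k. G i k = G k i"
    and G: "\<And>i k. has_weak_deriv \<Omega> [i, k] v (G i k) \<or> has_weak_deriv \<Omega> [k, i] v (G i k)"
    by blast+
  have a: "weak_deriv_on_bumps \<Omega> k (a i) (H i k)" for i k
    unfolding a_def by (rule second_weak_deriv_on_bumps[OF has_weak_deriv_weak_partial[OF assms(4)] H]) simp
  have b: "weak_deriv_on_bumps \<Omega> k (b i) (G i k)" for i k
    unfolding b_def by (rule second_weak_deriv_on_bumps[OF has_weak_deriv_weak_partial[OF assms(5)] G]) simp
  have "c i \<in> weakly_diff_space 1 \<Omega>" for i
    using assms(6) by (simp add: weakly_diff_fields_def c_def[abs_def])
  then have c: "weak_deriv_on_bumps \<Omega> k (c i) (D k i)" for i k
    unfolding D_def by (intro has_weak_deriv_imp_on_bumps has_weak_deriv_weak_partial) auto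
  have par: "AE x in lborel. x \<in> \<Omega> \<longrightarrow>
      (\<forall>i j. (a i x + c i x) * (a j x - b j x) = (a j x + c j x) * (a i x - b i x))"
    using assms(10)[unfolded on_iff]
  proof eventually_elim
    case (elim x)
    show ?case
    proof (intro impI allI)
      fix i j
      assume "x \<in> \<Omega>"
      with elim have "(weak_grad \<Omega> u x + F x) /\<^sub>R norm (weak_grad \<Omega> u x + F x) =
          (weak_grad \<Omega> v x + F x) /\<^sub>R norm (weak_grad \<Omega> v x + F x)"
        by (simp add: horizontal_normal_def)
      from equal_directions_imp_parallel[OF this, of i j]
      show "(a i x + c i x) * (a j x - b j x) = (a j x + c j x) * (a i x - b i x)"
        by (simp add: weak_grad_def a_def b_def c_def)
    qed
  qed
  have "AE x in lborel. \<forall>k. x \<in> \<Omega> \<longrightarrow> (\<forall>i j.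
      (H i k x + D k i x) * (a j x - b j x) + (a i x + c i x) * (H j k x - G j k x) =
      (H j k x + D k j x) * (a i x - b i x) + (a j x + c j x) * (H i k x - G i k x))"
    unfolding AE_all_countable
    by (intro allI product_rule_parallel_fields[OF \<open>open \<Omega>\<close> a b c par])
  then show ?thesis
    using assms(11)[unfolded on_iff] unfolding on_iff
  proof eventually_elim
    case (elim x)
    show ?case
    proof
      assume x: "x \<in> \<Omega>"
      define w where "w = weak_grad \<Omega> u x - weak_grad \<Omega> v x"
      have w: "w $ i = a i x - b i x" for i by (simp add: w_def weak_grad_def a_def b_def)
      let ?A = "curl_matrix \<Omega> F x"
      have A: "?A $ i $ j = D i j x - D j i x" for i j
        by (simp add: curl_matrix_def D_def c_def[abs_def])
      have cyc: "?A $ k $ i * w $ j + ?A $ i $ j * w $ k + ?A $ j $ k * w $ i = 0" for i j k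
      proof -
        have e: "(H i k x + D k i x) * w $ j + (a i x + c i x) * (H j k x - G j k x) =
            (H j k x + D k j x) * w $ i + (a j x + c j x) * (H i k x - G i k x)" for i j k
          using elim(1) x unfolding w by blast
        \<comment> \<open>In the cyclic sum the terms \<open>(\<nabla>u + F) \<otimes> D w\<close> cancel by symmetry of \<open>H\<close> and \<open>G\<close>, and
            so do the second derivatives \<open>H\<close> of \<open>u\<close> multiplied by \<open>w\<close>.\<close>
        show ?thesis
          using e[of i k j] e[of j i k] e[of k j i]
          unfolding A H_sym[of k i] H_sym[of k j] H_sym[of j i] G_sym[of k i] G_sym[of k j] G_sym[of j i]
          by (simp add: algebra_simps)
      qed
      have "rank ?A \<le> 2" if "w \<noteq> 0" by (rule rank_le_2_of_cyclic_identity[OF that cyc])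
      then have "w = 0" using elim(2) x by fastforce
      then show "weak_grad \<Omega> u x = weak_grad \<Omega> v x" by (simp add: w_def)
    qed
  qed
qed

end
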